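(* Let $G$ be a finite group and $N\trianglelefteq G$. Then there is a group isomorphism $$\mathcal U_{\mathrm{core}}(G)\cong\operatorname{Inf}_{G/N}^G\bigl(\mathcal U_{\mathrm{core}}(G/N)\bigr)\times\bigl(\mathcal U_{\mathrm{core}}(G)\cap\ker((-)^N)\bigr),$$ where $\ker((-)^N)$ is the kernel of the group homomorphism $(-)^N:\Omega(G)^\times\to\Omega(G/N)^\times$.
   Context: For a finite group $G$, $\Omega(G)$ is the Burnside ring (Grothendieck ring of finite $G$-sets), with $\mathbb Z$-basis $[G/H]$, $(H)$ running over the conjugacy classes of subgroups of $G$, and $1_{\Omega(G)}=[G/G]$. With $\operatorname{core}_G(H)=\bigcap_{g\in G}gHg^{-1}$, $\mathfrak n_G:\Omega(G)\to\Omega(G)$ is the additive map with $\mathfrak n_G([G/H])=[G/\operatorname{core}_G(H)]$, and $\mathcal U_{\mathrm{core}}(G):=\{u\in\Omega(G)^\times\mid\mathfrak n_G(u)=1_{\Omega(G)}\}$, the group of core-trivial units (a subgroup of $\Omega(G)^\times$). For $N\trianglelefteq G$, $\operatorname{Inf}_{G/N}^G:\Omega(G/N)\to\Omega(G)$ is the unital ring homomorphism obtained by viewing a $G/N$-set as a $G$-set via $G\to G/N$, and $(-)^N:\Omega(G)\to\Omega(G/N)$ is the unital ring homomorphism $[X]\mapsto[X^N]$ (with $X^N$ viewed as a $G/N$-set). Known result available (Yoshida's unit criterion): a conjugation-invariant function $H\mapsto\varepsilon_H\in\{\pm1\}$ on subgroups of $G$ is of the form $\varepsilon_H=\varphi_H^G(u)$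 for a unit $u$ of $\Omega(G)$ (where $\varphi_H^G([X])=\#X^H$) if and only if for every $K\le G$ the map $N_G(K)/K\to\{\pm1\}$, $gK\mapsto\varepsilon_{\langle K,g\rangle}/\varepsilon_K$, is a group homomorphism. *)

theory Defs
  imports "HOL-Algebra.Group_Action" "HOL-Algebra.Left_Coset" "HOL-Algebra.Ring"
begin

section \<open>Finite \<open>G\<close>-sets\<close>

text \<open>
  A \<open>G\<close>-set is a pair of a carrier set and an action in the sense of \<^locale>\<open>group_action\<close>;
  there every group element acts by an element of \<^const>\<open>Bij\<close>, i.e. by a function that is
  extensional on the carrier set, whence the restricted abstractions below.
\<close>

type_synonym ('a, 'x) gset = "'x set \<times> ('a \<Rightarrow> 'x \<Rightarrow> 'x)"

definition finite_gset :: "('a, 'm) monoid_scheme \<Rightarrow> ('a, 'x) gset \<Rightarrow> bool"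
  where "finite_gset G X \<longleftrightarrow> finite (fst X) \<and> group_action G (fst X) (snd X)"

definition gset_iso ::
  "('a, 'm) monoid_scheme \<Rightarrow> ('a, 'x) gset \<Rightarrow> ('a, 'y) gset \<Rightarrow> bool"
  where "gset_iso G X Y \<longleftrightarrow>
    (\<exists>f. bij_betw f (fst X) (fst Y) \<and>
         (\<forall>g\<in>carrier G. \<forall>x\<in>fst X. f (snd X g x) = snd Y g (f x)))"

definition gset_empty :: "('a, nat) gset"
  where "gset_empty = ({}, \<lambda>g. \<lambda>x\<in>{}. x)"

definition gset_sum :: "('a, 'x) gset \<Rightarrow> ('a, 'y) gset \<Rightarrow> ('a, 'x + 'y) gset"
  where "gset_sum X Y =
    (fst X <+> fst Y, \<lambda>g. \<lambda>z\<in>fst X <+> fst Y. map_sum (snd X g) (snd Y g) z)"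

definition gset_prod :: "('a, 'x) gset \<Rightarrow> ('a, 'y) gset \<Rightarrow> ('a, 'x \<times> 'y) gset"
  where "gset_prod X Y =
    (fst X \<times> fst Y, \<lambda>g. \<lambda>z\<in>fst X \<times> fst Y. map_prod (snd X g) (snd Y g) z)"

text \<open>The transitive \<open>G\<close>-set \<open>G/H\<close> of left cosets.\<close>

definition gset_cosets :: "('a, 'm) monoid_scheme \<Rightarrow> 'a set \<Rightarrow> ('a, 'a set) gset"
  where "gset_cosets G H =
    (lcosets\<^bsub>G\<^esub> H, \<lambda>g. \<lambda>C\<in>lcosets\<^bsub>G\<^esub> H. g <#\<^bsub>G\<^esub> C)"

text \<open>A \<open>G/N\<close>-set viewed as a \<open>G\<close>-set.\<close>

definition gset_inf ::
  "('a, 'm) monoid_scheme \<Rightarrow> 'a set \<Rightarrow> ('a set, 'x) gset \<Rightarrow> ('a, 'x) gset"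
  where "gset_inf G N X = (fst X, \<lambda>g. snd X (N #>\<^bsub>G\<^esub> g))"

text \<open>
  The \<open>N\<close>-fixed points of a \<open>G\<close>-set as a \<open>G/N\<close>-set: a coset acts through any of its
  representatives.
\<close>

definition gset_fix :: "'a set \<Rightarrow> ('a, 'x) gset \<Rightarrow> ('a set, 'x) gset"
  where "gset_fix N X =
    (let F = {x \<in> fst X. \<forall>n\<in>N. snd X n x = x}
     in (F, \<lambda>C. \<lambda>x\<in>F. snd X (SOME g. g \<in> C) x))"


section \<open>The Burnside ring\<close>

text \<open>
  Every finite \<open>G\<close>-set is isomorphic to one whose carrier is a set of natural numbers.
  The Burnside ring is therefore built from pairs \<open>(A, B)\<close> of finite \<open>G\<close>-sets on \<^typ>\<open>nat\<close>,
  a pair standing for the formal difference of \<open>A\<close> and \<open>B\<close>; its elements are the classes of the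
  usual Grothendieck equivalence relation. The class of \<open>(X, Y)\<close> is defined for \<open>X\<close> and \<open>Y\<close> on
  arbitrary types, so that sums, products, coset spaces etc. need not be re-encoded on \<^typ>\<open>nat\<close>.
\<close>

type_synonym 'a burnside = "(('a, nat) gset \<times> ('a, nat) gset) set"

definition gset_diff ::
  "('a, 'm) monoid_scheme \<Rightarrow> ('a, 'x) gset \<Rightarrow> ('a, 'y) gset \<Rightarrow> 'a burnside"
  where "gset_diff G X Y =
    {(A, B). finite_gset G A \<and> finite_gset G B \<and>
       (\<exists>Z :: ('a, nat) gset. finite_gset G Z \<and>
          gset_iso G (gset_sum (gset_sum A Y) Z) (gset_sum (gset_sum X B) Z))}"

definition gset_class :: "('a, 'm) monoid_scheme \<Rightarrow> ('a, 'x) gset \<Rightarrow> 'a burnside"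
  where "gset_class G X = gset_diff G X gset_empty"

text \<open>
  In the operations below all pairs of representatives give the same class, so that the unions
  are unions of copies of one class.
\<close>

definition burnside_ring :: "('a, 'm) monoid_scheme \<Rightarrow> 'a burnside ring"
  where "burnside_ring G =
    \<lparr>carrier = {gset_diff G A B | (A :: ('a, nat) gset) (B :: ('a, nat) gset).
                  finite_gset G A \<and> finite_gset G B},
     mult = (\<lambda>u v. \<Union>(A, B)\<in>u. \<Union>(C, D)\<in>v.
               gset_diff G (gset_sum (gset_prod A C) (gset_prod B D))
                           (gset_sum (gset_prod A D) (gset_prod B C))),
     one = gset_class G (gset_cosets G (carrier G)),
     zero = gset_class G gset_empty,
     add = (\<lambda>u v. \<Union>(A, B)\<in>u. \<Union>(C, D)\<in>v.
              gset_diff G (gset_sum A C) (gset_sum B D))\<rparr>"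

definition burnside_inf ::
  "('a, 'm) monoid_scheme \<Rightarrow> 'a set \<Rightarrow> 'a set burnside \<Rightarrow> 'a burnside"
  where "burnside_inf G N u =
    (\<Union>(A, B)\<in>u. gset_diff G (gset_inf G N A) (gset_inf G N B))"

definition burnside_fix ::
  "('a, 'm) monoid_scheme \<Rightarrow> 'a set \<Rightarrow> 'a burnside \<Rightarrow> 'a set burnside"
  where "burnside_fix G N u =
    (\<Union>(A, B)\<in>u. gset_diff (G Mod N) (gset_fix N A) (gset_fix N B))"


section \<open>Core-trivial units\<close>

definition core :: "('a, 'm) monoid_scheme \<Rightarrow> 'a set \<Rightarrow> 'a set"
  where "core G H = (\<Inter>g\<in>carrier G. g <#\<^bsub>G\<^esub> H #>\<^bsub>G\<^esub> inv\<^bsub>G\<^esub> g)"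

text \<open>
  The additive map sending each basis element \<open>[G/H]\<close> to \<open>[G/core H]\<close>; extensionality pins
  down its values outside of the carrier, so that it is unique.
\<close>

definition burnside_n :: "('a, 'm) monoid_scheme \<Rightarrow> 'a burnside \<Rightarrow> 'a burnside"
  where "burnside_n G =
    (THE f. f \<in> extensional (carrier (burnside_ring G)) \<and>
            f \<in> hom (add_monoid (burnside_ring G)) (add_monoid (burnside_ring G)) \<and>
            (\<forall>H. subgroup H G \<longrightarrow>
               f (gset_class G (gset_cosets G H)) = gset_class G (gset_cosets G (core G H))))"

abbreviation burnside_units :: "('a, 'm) monoid_scheme \<Rightarrow> 'a burnside monoid"
  where "burnside_units G \<equiv> units_of (burnside_ring G)"

definition core_units :: "('a, 'm) monoid_scheme \<Rightarrow> 'a burnside set"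
  where "core_units G =
    {u \<in> carrier (burnside_units G). burnside_n G u = \<one>\<^bsub>burnside_ring G\<^esub>}"

end

theory Submission
  imports Defs Complex_Main
begin

text \<open>
  An element of the Burnside ring is determined by its marks, and a unit has marks \<open>\<plusminus>1\<close>, hence is its
  own inverse. The number of orbits of \<open>G\<close> on \<open>X\<^sup>M\<close>, for \<open>M\<close> normal, is both a sum of coefficients
  of \<open>[X]\<close>, namely over the \<open>[G/H]\<close> with \<open>M \<subseteq> core H\<close>, and the average over \<open>g\<close> of the marks of \<open>X\<close>
  at \<open>\<langle>M, g\<rangle>\<close>. An average of signs is \<open>1\<close> only if all of them are, so by Moebius inversion over the
  normal subgroups a unit \<open>u\<close> is core-trivial iff its mark at \<open>\<langle>M, g\<rangle>\<close> is \<open>1\<close> for all normal \<open>M\<close> and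
  all \<open>g\<close>. This condition is multiplicative and preserved by inflation and by \<open>N\<close>-fixed points. As
  \<open>N\<close>-fixed points are a left inverse of inflation, \<open>u \<mapsto> (p u, u \<cdot> p u)\<close> with
  \<open>p u = Inf (u\<^sup>N)\<close> splits the group.
\<close>

text \<open>The map \<open>burnside_n\<close> is additive but in general not multiplicative, so even
  closure of the core-trivial units under products is not formal; this is why they are recast as a
  condition on marks. Marks of [X], marks of its image under \<open>burnside_n\<close> and orbit
  counts are all sums over the points of X of a weight of the stabilizer. Linear relations between
  them thus reduce to identities between weights at a single subgroup. Let c(M) be the sum of the
  coefficients of \<open>u\<close> at the [G/H] with core M. The mark of
  \<open>burnside_n G u\<close> at K is the sum of |G : M| c(M) over the normal M containing K; the
  orbit count at a normal M is the sum of c(M') over the normal M' containing M. Both systems are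
  triangular for inclusion, and prescribing the value 1 everywhere has the same solution in both: c
  is 1 at G and 0 elsewhere. Hence the condition on \<open>burnside_n\<close> passes to the orbit
  counts. Marks are taken at bare sets \<open>insert g M\<close>: a stabilizer is a subgroup and
  cannot tell such a set from the subgroup it generates.\<close>

lemma UN_const_pair:
  assumes "\<And>a b. (a, b) \<in> U \<Longrightarrow> f a b = K" "(a, b) \<in> U"
  shows "(\<Union>(a, b)\<in>U. f a b) = K"
  using assms by (intro UN_constant_eq[of "(a, b)"]) auto

definition gset_restrict :: "('a, 'x) gset \<Rightarrow> 'x set \<Rightarrow> ('a, 'x) gset"
  where "gset_restrict X S = (S, \<lambda>g. restrict (snd X g) S)"

definition stab_sum ::
  "('a, 'm) monoid_scheme \<Rightarrow> ('a set \<Rightarrow> real) \<Rightarrow> ('a, 'x) gset \<Rightarrow> real"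
  where "stab_sum G w X = (\<Sum>x\<in>fst X. w (stabilizer G (snd X) x))"

text \<open>Since \<open>H\<close> fixes \<open>x\<close> iff it lies in the stabilizer of \<open>x\<close>, this is the number of \<open>H\<close>-fixed
  points; \<open>H\<close> need not be a subgroup.\<close>

abbreviation mark :: "('a, 'm) monoid_scheme \<Rightarrow> ('a, 'x) gset \<Rightarrow> 'a set \<Rightarrow> real"
  where "mark G X H \<equiv> stab_sum G (\<lambda>S. of_bool (H \<subseteq> S)) X"

text \<open>All representatives of an element of the Burnside ring give the same difference, so that
  the one chosen does not matter. Marks are kept real-valued, for \<open>core_weight\<close> below.\<close>

definition virt_sum :: "('a, 'm) monoid_scheme \<Rightarrow> ('a set \<Rightarrow> real) \<Rightarrow> 'a burnside \<Rightarrow> real"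
  where "virt_sum G w u = (case (SOME p. p \<in> u) of (A, B) \<Rightarrow> stab_sum G w A - stab_sum G w B)"

abbreviation vmark :: "('a, 'm) monoid_scheme \<Rightarrow> 'a burnside \<Rightarrow> 'a set \<Rightarrow> real"
  where "vmark G u H \<equiv> virt_sum G (\<lambda>S. of_bool (H \<subseteq> S)) u"

text \<open>Moebius inversion for a constant right-hand side. The top set \<open>C\<close> occurs in
  every superset sum, so concentrating \<open>c\<close> there is a solution; it is the only one
  because the system is triangular for inclusion.\<close>

lemma superset_sum_const_iff:
  fixes e :: "'b set \<Rightarrow> real"
  assumes F: "finite F" "C \<in> F" "\<And>M. M \<in> F \<Longrightarrow> M \<subseteq> C"
  shows "(\<forall>M\<in>F. (\<Sum>M'\<in>F. of_bool (M \<subseteq> M') * e M') = c) \<longleftrightarrow>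
    (\<forall>M\<in>F. e M = (if M = C then c else 0))"
proof
  assume e: "\<forall>M\<in>F. e M = (if M = C then c else 0)"
  show "\<forall>M\<in>F. (\<Sum>M'\<in>F. of_bool (M \<subseteq> M') * e M') = c"
  proof
    fix M assume "M \<in> F"
    then have "(\<Sum>M'\<in>F. of_bool (M \<subseteq> M') * e M') = (\<Sum>M'\<in>F. if M' = C then c else 0)"
      using e F by (intro sum.cong) auto
    then show "(\<Sum>M'\<in>F. of_bool (M \<subseteq> M') * e M') = c"
      using F by simp
  qed
next
  assume sums: "\<forall>M\<in>F. (\<Sum>M'\<in>F. of_bool (M \<subseteq> M') * e M') = c"
  have "e M = (if M = C then c else 0)" if "M \<in> F" for M
    using that
  proof (induction "card {M'\<in>F. M \<subset> M'}" arbitrary: M rule: less_induct)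
    case less
    let ?A = "{M'\<in>F. M \<subset> M'}"
    have "(\<Sum>M'\<in>F. of_bool (M \<subseteq> M') * e M') = (\<Sum>M'\<in>insert M ?A. e M')"
      using F less.prems by (intro sum.mono_neutral_cong_right) auto
    then have "c = e M + (\<Sum>M'\<in>?A. e M')"
      using F sums less.prems by simp
    moreover have "(\<Sum>M'\<in>?A. e M') = (\<Sum>M'\<in>?A. if M' = C then c else 0)"
    proof (intro sum.cong refl less.hyps)
      fix M' assume "M' \<in> ?A"
      then show "card {K\<in>F. M' \<subset> K} < card ?A"
        using F by (intro psubset_card_mono) auto
    qed auto
    \<comment> \<open>If \<open>M\<close> is not \<open>C\<close>, then \<open>C\<close> is a proper
      superset and already uses up the constant, which leaves 0 for \<open>M\<close>; if
      \<open>M = C\<close>, there are no proper supersets in \<open>F\<close>.\<close>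
    moreover have "(\<Sum>M'\<in>?A. if M' = C then c else 0) = (if M = C then 0 else c)"
      using F less.prems by (auto simp: psubset_eq)
    ultimately show ?case
      by (simp split: if_splits)
  qed
  then show "\<forall>M\<in>F. e M = (if M = C then c else 0)"
    by blast
qed

text \<open>The weight \<open>S \<mapsto> |S : core S|\<close> turns the marks of \<open>X\<close> into those of its image under
  \<^const>\<open>burnside_n\<close>, as \<open>|G : S| |S : core S| = |G : core S|\<close>.\<close>

definition core_index :: "('a, 'm) monoid_scheme \<Rightarrow> 'a set \<Rightarrow> real"
  where "core_index G S = card S / card (core G S)"

abbreviation core_weight :: "('a, 'm) monoid_scheme \<Rightarrow> 'a set \<Rightarrow> 'a set \<Rightarrow> real"
  where "core_weight G K S \<equiv> of_bool (K \<subseteq> core G S) * core_index G S"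

section \<open>Conjugates, cores and normal subgroups\<close>

context group
begin

lemma conj_mem_iff:
  assumes "S \<subseteq> carrier G" "g \<in> carrier G"
  shows "x \<in> g <# S #> inv g \<longleftrightarrow> x \<in> carrier G \<and> inv g \<otimes> x \<otimes> g \<in> S"
proof
  assume "x \<in> g <# S #> inv g"
  then obtain s where s: "s \<in> S" "x = g \<otimes> s \<otimes> inv g"
    by (auto simp: l_coset_def r_coset_def)
  moreover have "s \<in> carrier G"
    using s assms by auto
  moreover have "inv g \<otimes> (g \<otimes> s \<otimes> inv g) \<otimes> g = s"
    using assms calculation by (simp add: m_assoc) (simp add: m_assoc[symmetric])
  ultimately show "x \<in> carrier G \<and> inv g \<otimes> x \<otimes> g \<in> S"
    using assms by simp
next
  assume x: "x \<in> carrier G \<and> inv g \<otimes> x \<otimes> g \<in> S"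
  then have "x = g \<otimes> (inv g \<otimes> x \<otimes> g) \<otimes> inv g"
    using assms by (simp add: m_assoc) (simp add: m_assoc[symmetric])
  then show "x \<in> g <# S #> inv g"
    using x by (auto simp: l_coset_def r_coset_def)
qed

lemma core_mem_iff:
  assumes "S \<subseteq> carrier G"
  shows "x \<in> core G S \<longleftrightarrow> x \<in> carrier G \<and> (\<forall>g\<in>carrier G. inv g \<otimes> x \<otimes> g \<in> S)"
  unfolding core_def using assms conj_mem_iff one_closed by auto

text \<open>Conjugating \<open>S\<close> by \<open>g\<close> only permutes the conjugates being
  intersected, through right translation of the index by \<open>g\<close>. Hence weights built from
  the core are constant on the stabilizers of an orbit.\<close>

lemma core_conj:
  assumes "S \<subseteq> carrier G" "g \<in> carrier G"
  shows "core G (g <# S #> inv g) = core G S"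
proof -
  have sub: "g <# S #> inv g \<subseteq> carrier G"
    using conj_mem_iff[OF assms] by blast
  have eq: "inv g \<otimes> (inv a \<otimes> x \<otimes> a) \<otimes> g = inv (a \<otimes> g) \<otimes> x \<otimes> (a \<otimes> g)"
    if "a \<in> carrier G" "x \<in> carrier G" for a x
    using that assms by (simp add: inv_mult_group m_assoc)
  have "x \<in> core G (g <# S #> inv g) \<longleftrightarrow> x \<in> core G S" for x
  proof -
    have "inv a \<otimes> x \<otimes> a \<in> S"
      if "x \<in> carrier G" "a \<in> carrier G" "\<forall>a\<in>carrier G. inv g \<otimes> (inv a \<otimes> x \<otimes> a) \<otimes> g \<in> S" for a
    proof -
      have "inv g \<otimes> (inv (a \<otimes> inv g) \<otimes> x \<otimes> (a \<otimes> inv g)) \<otimes> g \<in> S"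
        using that assms by blast
      moreover have "a \<otimes> inv g \<otimes> g = a"
        using that assms by (simp add: m_assoc)
      ultimately show ?thesis
        using eq[of "a \<otimes> inv g" x] that assms by simp
    qed
    moreover have "inv g \<otimes> (inv a \<otimes> x \<otimes> a) \<otimes> g \<in> S"
      if "x \<in> carrier G" "a \<in> carrier G" "\<forall>a\<in>carrier G. inv a \<otimes> x \<otimes> a \<in> S" for a
      using that eq[OF that(2,1)] assms by simp
    ultimately show ?thesis
      unfolding core_mem_iff[OF sub] core_mem_iff[OF assms(1)] conj_mem_iff[OF assms]
      by (meson inv_closed m_closed)
  qed
  then show ?thesis
    by blast
qed

lemma card_conj:
  assumes "S \<subseteq> carrier G" "g \<in> carrier G"
  shows "card (g <# S #> inv g) = card S"
proof -
  have "g <# S #> inv g = (\<lambda>s. g \<otimes> s \<otimes> inv g) ` S"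
    by (auto simp: l_coset_def r_coset_def)
  moreover have "inj_on (\<lambda>s. g \<otimes> s \<otimes> inv g) S"
    using assms by (intro inj_onI) (auto simp: subset_iff)
  ultimately show ?thesis
    by (simp add: card_image)
qed

lemma core_subset:
  assumes "S \<subseteq> carrier G"
  shows "core G S \<subseteq> S"
proof
  fix x assume "x \<in> core G S"
  then have "x \<in> carrier G" "inv \<one> \<otimes> x \<otimes> \<one> \<in> S"
    using core_mem_iff[OF assms] one_closed by blast+
  then show "x \<in> S"
    by simp
qed

text \<open>With \<open>core_subset\<close> and \<open>normal_core\<close> this makes the core of a
  subgroup the largest normal subgroup inside it, so for normal \<open>M\<close> the test
  \<open>M \<subseteq> S\<close> depends on \<open>core G S\<close> alone.\<close>

lemma subset_core:
  assumes "M \<lhd> G" "M \<subseteq> S" "S \<subseteq> carrier G"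
  shows "M \<subseteq> core G S"
proof
  fix x assume x: "x \<in> M"
  have "inv g \<otimes> x \<otimes> g \<in> M" if "g \<in> carrier G" for g
    using assms(1) that x by (rule normal.inv_op_closed1)
  then show "x \<in> core G S"
    unfolding core_mem_iff[OF assms(3)] using assms x by auto
qed

lemma normal_core:
  assumes "subgroup S G"
  shows "core G S \<lhd> G"
proof -
  interpret S: subgroup S G by fact
  note mem = core_mem_iff[OF S.subset]
  have "subgroup (core G S) G"
  proof (rule subgroupI)
    show "core G S \<noteq> {}"
      using mem[of \<one>] by auto
    show "inv a \<in> core G S" if "a \<in> core G S" for a
    proof -
      have "inv g \<otimes> inv a \<otimes> g \<in> S" if "g \<in> carrier G" for g
      proof -
        have "inv (inv g \<otimes> a \<otimes> g) \<in> S"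
          using \<open>a \<in> core G S\<close> that mem by blast
        then show ?thesis
          using \<open>a \<in> core G S\<close> that mem by (simp add: inv_mult_group m_assoc)
      qed
      then show ?thesis
        using that mem by simp
    qed
    show "a \<otimes> b \<in> core G S" if "a \<in> core G S" "b \<in> core G S" for a b
    proof -
      have "inv g \<otimes> (a \<otimes> b) \<otimes> g \<in> S" if "g \<in> carrier G" for g
      proof -
        have ab: "a \<in> carrier G" "b \<in> carrier G"
          using \<open>a \<in> core G S\<close> \<open>b \<in> core G S\<close> mem by auto
        have "(inv g \<otimes> a \<otimes> g) \<otimes> (inv g \<otimes> b \<otimes> g) \<in> S"
          using \<open>a \<in> core G S\<close> \<open>b \<in> core G S\<close> that mem by blast
        moreover have "(inv g \<otimes> a \<otimes> g) \<otimes> (inv g \<otimes> b \<otimes> g) = inv g \<otimes> (a \<otimes> b) \<otimes> g"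
        proof -
          have "g \<otimes> (inv g \<otimes> y) = y" if "y \<in> carrier G" for y
            using that \<open>g \<in> carrier G\<close> by (simp add: m_assoc[symmetric])
          then show ?thesis
            using ab that by (simp add: m_assoc)
        qed
        ultimately show ?thesis
          by simp
      qed
      then show ?thesis
        using that mem by simp
    qed
  qed (use mem in auto)
  moreover have "x \<otimes> h \<otimes> inv x \<in> core G S" if "x \<in> carrier G" "h \<in> core G S" for x h
  proof -
    have "inv g \<otimes> (x \<otimes> h \<otimes> inv x) \<otimes> g \<in> S" if g: "g \<in> carrier G" for g
    proof -
      have "inv (inv x \<otimes> g) \<otimes> h \<otimes> (inv x \<otimes> g) \<in> S"
        using that \<open>x \<in> carrier G\<close> \<open>h \<in> core G S\<close> mem m_closed inv_closed by blast
      then show ?thesis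
        using that \<open>x \<in> carrier G\<close> \<open>h \<in> core G S\<close> mem by (simp add: inv_mult_group m_assoc)
    qed
    then show ?thesis
      using that mem by simp
  qed
  ultimately show ?thesis
    by (simp add: normal_inv_iff)
qed

lemma normal_subset: "M \<lhd> G \<Longrightarrow> M \<subseteq> carrier G"
  by (simp add: normal_imp_subgroup subgroup.subset)


lemma normal_conj:
  assumes "M \<lhd> G" "g \<in> carrier G"
  shows "g <# M #> inv g = M"
proof -
  have "g <# M #> inv g = M #> g #> inv g"
    using assms by (simp add: normal.coset_eq)
  then show ?thesis
    using assms normal_subset[OF assms(1)] by (simp add: coset_mult_assoc)
qed

subsection \<open>Finite \<open>G\<close>-sets and their marks\<close>

text \<open>Bijectivity of \<open>\<phi> g\<close> comes from \<open>\<phi> (inv g)\<close> as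
  two-sided inverse; extensionality is what makes equality in \<open>BijGroup E\<close> a pointwise
  matter.\<close>

lemma group_actionI:
  assumes "\<And>g x. g \<in> carrier G \<Longrightarrow> x \<in> E \<Longrightarrow> \<phi> g x \<in> E"
    and "\<And>g. g \<in> carrier G \<Longrightarrow> \<phi> g \<in> extensional E"
    and "\<And>x. x \<in> E \<Longrightarrow> \<phi> \<one> x = x"
    and "\<And>g h x. g \<in> carrier G \<Longrightarrow> h \<in> carrier G \<Longrightarrow> x \<in> E \<Longrightarrow> \<phi> (g \<otimes> h) x = \<phi> g (\<phi> h x)"
  shows "group_action G E \<phi>"
proof -
  have B: "\<phi> g \<in> Bij E" if g: "g \<in> carrier G" for g
  proof -
    have "bij_betw (\<phi> g) E E"
    proof (rule bij_betw_byWitness[where f' = "\<phi> (inv g)"])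
      show "\<forall>x\<in>E. \<phi> (inv g) (\<phi> g x) = x"
        using assms(3) assms(4)[of "inv g" g] g by simp
      show "\<forall>x\<in>E. \<phi> g (\<phi> (inv g) x) = x"
        using assms(3) assms(4)[of g "inv g"] g by simp
    qed (use assms(1) g in auto)
    then show ?thesis
      using assms(2)[OF g] by (simp add: Bij_def)
  qed
  have "\<phi> \<in> hom G (BijGroup E)"
  proof (rule homI)
    show "\<phi> g \<in> carrier (BijGroup E)" if "g \<in> carrier G" for g
      using B[OF that] by (simp add: BijGroup_def)
    show "\<phi> (g \<otimes> h) = \<phi> g \<otimes>\<^bsub>BijGroup E\<^esub> \<phi> h" if "g \<in> carrier G" "h \<in> carrier G" for g h
    proof -
      have "\<phi> (g \<otimes> h) = compose E (\<phi> g) (\<phi> h)"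
        by (rule extensionalityI[where A = E]) (use assms(2,4) that in \<open>auto simp: compose_def\<close>)
      then show ?thesis
        using B that by (simp add: BijGroup_def)
    qed
  qed
  then show ?thesis
    by (simp add: group_action_def group_hom_def group_hom_axioms_def group_BijGroup is_group)
qed

lemma finite_gset_iff:
  "finite_gset G X \<longleftrightarrow> finite (fst X) \<and>
     (\<forall>g\<in>carrier G. \<forall>x\<in>fst X. snd X g x \<in> fst X) \<and>
     (\<forall>g\<in>carrier G. snd X g \<in> extensional (fst X)) \<and>
     (\<forall>x\<in>fst X. snd X \<one> x = x) \<and>
     (\<forall>g\<in>carrier G. \<forall>h\<in>carrier G. \<forall>x\<in>fst X. snd X (g \<otimes> h) x = snd X g (snd X h x))"
  (is "_ \<longleftrightarrow> ?R")
proof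
  assume X: "finite_gset G X"
  then interpret group_action G "fst X" "snd X"
    by (simp add: finite_gset_def)
  show ?R
    using X element_image composition_rule bij_prop0 id_eq_one
    by (metis Bij_imp_extensional finite_gset_def restrict_apply')
next
  assume ?R
  then show "finite_gset G X"
    by (auto simp: finite_gset_def intro!: group_actionI)
qed

lemma gset_act_inv:
  assumes "finite_gset G X" "g \<in> carrier G" "x \<in> fst X" "y \<in> fst X"
  shows "snd X g x = y \<longleftrightarrow> x = snd X (inv g) y"
proof -
  have "snd X (inv g \<otimes> g) x = snd X (inv g) (snd X g x)" "snd X (g \<otimes> inv g) y = snd X g (snd X (inv g) y)"
    using assms by (metis finite_gset_iff inv_closed)+
  moreover have "snd X \<one> x = x" "snd X \<one> y = y"
    using assms by (auto simp: finite_gset_iff)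
  ultimately show ?thesis
    using assms by auto
qed

section \<open>Closure of finite G-sets under the basic constructions\<close>

lemma finite_gset_empty: "finite_gset G gset_empty"
  by (auto simp: finite_gset_iff gset_empty_def restrict_def extensional_def)

lemma finite_gset_sum:
  assumes "finite_gset G X" "finite_gset G Y"
  shows "finite_gset G (gset_sum X Y)"
  using assms by (auto simp: finite_gset_iff gset_sum_def)

lemma finite_gset_prod:
  assumes "finite_gset G X" "finite_gset G Y"
  shows "finite_gset G (gset_prod X Y)"
  using assms by (auto simp: finite_gset_iff gset_prod_def)

lemma finite_gset_cosets:
  assumes "finite (carrier G)" "subgroup H G"
  shows "finite_gset G (gset_cosets G H)"
proof -
  have H: "H \<subseteq> carrier G"
    by (rule subgroup.subset[OF assms(2)])
  have "finite (lcosets H)"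
    by (simp add: LCOSETS_def assms)
  moreover have C: "C \<subseteq> carrier G" if "C \<in> lcosets H" for C
    using that H by (auto simp: LCOSETS_def l_coset_def)
  moreover have "g <# C \<in> lcosets H" if "C \<in> lcosets H" "g \<in> carrier G" for C g
    using that H by (auto simp: LCOSETS_def lcos_m_assoc)
  ultimately show ?thesis
    by (auto simp: finite_gset_iff gset_cosets_def lcos_m_assoc lcos_mult_one)
qed

lemma finite_gset_restrict:
  assumes "finite_gset G X" "S \<subseteq> fst X" "\<And>g x. g \<in> carrier G \<Longrightarrow> x \<in> S \<Longrightarrow> snd X g x \<in> S"
  shows "finite_gset G (gset_restrict X S)"
  using assms by (auto simp: finite_gset_iff gset_restrict_def finite_subset subset_iff)

section \<open>Isomorphisms of G-sets\<close>

lemma gset_iso_refl: "gset_iso G X X"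
  unfolding gset_iso_def by (rule exI[of _ id]) auto

lemma gset_iso_sym:
  assumes "finite_gset G X" "gset_iso G X Y"
  shows "gset_iso G Y X"
proof -
  obtain f where f: "bij_betw f (fst X) (fst Y)"
    "\<And>g x. g \<in> carrier G \<Longrightarrow> x \<in> fst X \<Longrightarrow> f (snd X g x) = snd Y g (f x)"
    using assms by (auto simp: gset_iso_def)
  have "inv_into (fst X) f (snd Y g y) = snd X g (inv_into (fst X) f y)"
    if "g \<in> carrier G" "y \<in> fst Y" for g y
  proof -
    obtain x where "x \<in> fst X" "y = f x"
      using f(1) \<open>y \<in> fst Y\<close> by (auto simp: bij_betw_def)
    moreover have "snd X g x \<in> fst X"
      using assms(1) that calculation by (auto simp: finite_gset_iff)
    ultimately show ?thesis
      using f that by (metis bij_betw_inv_into_left)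
  qed
  then show ?thesis
    using f(1) by (auto simp: gset_iso_def intro!: exI[of _ "inv_into (fst X) f"] bij_betw_inv_into)
qed

lemma gset_iso_trans:
  assumes "gset_iso G X Y" "gset_iso G Y Z"
  shows "gset_iso G X Z"
proof -
  obtain f where f: "bij_betw f (fst X) (fst Y)"
    "\<And>g x. g \<in> carrier G \<Longrightarrow> x \<in> fst X \<Longrightarrow> f (snd X g x) = snd Y g (f x)"
    using assms(1) by (auto simp: gset_iso_def)
  obtain f' where f': "bij_betw f' (fst Y) (fst Z)"
    "\<And>g x. g \<in> carrier G \<Longrightarrow> x \<in> fst Y \<Longrightarrow> f' (snd Y g x) = snd Z g (f' x)"
    using assms(2) by (auto simp: gset_iso_def)
  have "f x \<in> fst Y" if "x \<in> fst X" for x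
    using f(1) that by (auto simp: bij_betw_def)
  then show ?thesis
    using f f' bij_betw_trans[OF f(1) f'(1)]
    by (auto simp: gset_iso_def intro!: exI[of _ "f' \<circ> f"])
qed

lemma gset_iso_sum:
  assumes "gset_iso G X X'" "gset_iso G Y Y'"
  shows "gset_iso G (gset_sum X Y) (gset_sum X' Y')"
proof -
  obtain f where f: "bij_betw f (fst X) (fst X')"
    "\<And>g x. g \<in> carrier G \<Longrightarrow> x \<in> fst X \<Longrightarrow> f (snd X g x) = snd X' g (f x)"
    using assms(1) by (auto simp: gset_iso_def)
  obtain f' where f': "bij_betw f' (fst Y) (fst Y')"
    "\<And>g x. g \<in> carrier G \<Longrightarrow> x \<in> fst Y \<Longrightarrow> f' (snd Y g x) = snd Y' g (f' x)"
    using assms(2) by (auto simp: gset_iso_def)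
  have "bij_betw (map_sum f f') (fst X <+> fst Y) (fst X' <+> fst Y')"
  proof -
    have "inj_on (map_sum f f') (fst X <+> fst Y)"
      using f(1)[THEN bij_betw_imp_inj_on, THEN inj_onD] f'(1)[THEN bij_betw_imp_inj_on, THEN inj_onD]
      by (intro inj_onI) (elim PlusE; simp)
    moreover have "map_sum f f' ` (fst X <+> fst Y) = f ` fst X <+> f' ` fst Y"
      by (auto simp: Plus_def image_Un image_image)
    ultimately show ?thesis
      using f(1) f'(1) by (simp add: bij_betw_def)
  qed
  moreover have "f x \<in> fst X'" if "x \<in> fst X" for x
    using f(1) that by (auto simp: bij_betw_def)
  moreover have "f' x \<in> fst Y'" if "x \<in> fst Y" for x
    using f'(1) that by (auto simp: bij_betw_def)
  ultimately show ?thesis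
    using f f' by (auto simp: gset_iso_def gset_sum_def intro!: exI[of _ "map_sum f f'"])
qed


text \<open>Sums, products and coset spaces leave the type \<open>nat\<close>; transporting the
  action along an injection of the finite carrier returns them to the type on which representatives
  live.\<close>

lemma gset_nat_copy:
  fixes X :: "('a, 'x) gset"
  assumes X: "finite_gset G X"
  obtains A :: "('a, nat) gset" where "finite_gset G A" "gset_iso G X A"
proof -
  obtain f :: "'x \<Rightarrow> nat" where f: "inj_on f (fst X)"
    using X finite_imp_inj_to_nat_seg by (metis finite_gset_def)
  let ?i = "inv_into (fst X) f"
  let ?A = "(f ` fst X, \<lambda>g. \<lambda>n\<in>f ` fst X. f (snd X g (?i n)))"
  have "finite_gset G ?A"
    using X f by (auto simp: finite_gset_iff)
  moreover have "gset_iso G X ?A"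
    unfolding gset_iso_def using f by (intro exI[of _ f]) (auto simp: bij_betw_def)
  ultimately show ?thesis
    using that by blast
qed


text \<open>The orbit-stabilizer theorem in equivariant form. The rest keeps the type of
  \<open>X\<close> and has fewer points, as inductions over orbits require.\<close>

lemma gset_decompose:
  fixes X :: "('a, 'x) gset"
  assumes X: "finite_gset G X" and x: "x \<in> fst X" and fin: "finite (carrier G)"
  obtains X' :: "('a, 'x) gset" where "finite_gset G X'" "card (fst X') < card (fst X)"
    "gset_iso G X (gset_sum (gset_cosets G (stabilizer G (snd X) x)) X')"
proof -
  interpret group_action G "fst X" "snd X"
    using X by (simp add: finite_gset_def)
  define H where "H = stabilizer G (snd X) x"
  define O' where "O' = orbit G (snd X) x"
  define X' where "X' = gset_restrict X (fst X - O')"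
  have act: "snd X g y \<in> fst X" if "g \<in> carrier G" "y \<in> fst X" for g y
    using X that by (auto simp: finite_gset_iff)
  have O_sub: "O' \<subseteq> fst X"
    using act x by (auto simp: O'_def orbit_def)
  \<comment> \<open>The direction from \<open>snd X g y\<close> back to \<open>y\<close> is what
    makes the complement of the orbit stable under the action.\<close>
  have O_cl: "snd X g y \<in> O' \<longleftrightarrow> y \<in> O'" if "g \<in> carrier G" "y \<in> fst X" for g y
  proof
    assume "y \<in> O'"
    then obtain h where "h \<in> carrier G" "y = snd X h x"
      by (auto simp: O'_def orbit_def)
    then show "snd X g y \<in> O'"
      using that composition_rule[OF x] unfolding O'_def orbit_def
      by (auto intro!: exI[of _ "g \<otimes> h"])
  next
    assume "snd X g y \<in> O'"
    then obtain h where h: "h \<in> carrier G" "snd X g y = snd X h x"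
      by (auto simp: O'_def orbit_def)
    then have "y = snd X (inv g) (snd X h x)"
      using gset_act_inv[OF X] that x act by metis
    then show "y \<in> O'"
      using composition_rule[OF x] h that unfolding O'_def orbit_def
      by (auto intro!: exI[of _ "inv g \<otimes> h"])
  qed
  have xO: "x \<in> O'"
    using x orbit_refl by (simp add: O'_def)
  have "finite_gset G X'"
    unfolding X'_def using O_cl act by (intro finite_gset_restrict[OF X]) auto
  moreover have "card (fst X') < card (fst X)"
    using X x xO by (auto simp: X'_def gset_restrict_def finite_gset_def intro!: psubset_card_mono)
  moreover have "gset_iso G X (gset_sum (gset_cosets G H) X')"
  proof -
    \<comment> \<open>\<open>T y\<close> is the transporter from \<open>x\<close> to
      \<open>y\<close>. It is a left coset of the stabilizer, and moving \<open>y\<close> by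
      \<open>k\<close> translates it by \<open>k\<close>, so \<open>T\<close> identifies the orbit
      with the coset space without a choice of representatives.\<close>
    define T where "T y = {g \<in> carrier G. snd X g x = y}" for y
    have T: "T (snd X g x) = g <# H" if g: "g \<in> carrier G" for g
    proof (intro equalityI subsetI)
      fix k assume "k \<in> T (snd X g x)"
      then have k: "k \<in> carrier G" "snd X k x = snd X g x"
        by (auto simp: T_def)
      then have "inv g \<otimes> k \<in> H"
        using g x gset_act_inv[OF X g x] composition_rule[OF x] act unfolding H_def stabilizer_def
        by (auto) (metis gset_act_inv X)
      moreover have "k = g \<otimes> (inv g \<otimes> k)"
        using g k by (simp add: m_assoc[symmetric])
      ultimately show "k \<in> g <# H"
        by (auto simp: l_coset_def)
    next
      fix k assume "k \<in> g <# H"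
      then show "k \<in> T (snd X g x)"
        using g composition_rule[OF x] by (auto simp: T_def l_coset_def H_def stabilizer_def)
    qed
    have T_act: "T (snd X k y) = k <# T y" if ky: "k \<in> carrier G" "y \<in> O'" for k y
    proof -
      obtain g where g: "g \<in> carrier G" "y = snd X g x"
        using ky by (auto simp: O'_def orbit_def)
      have H: "H \<subseteq> carrier G"
        by (auto simp: H_def stabilizer_def)
      have "T (snd X k y) = (k \<otimes> g) <# H"
        using T[of "k \<otimes> g"] g ky composition_rule[OF x] by simp
      then show ?thesis
        using T[OF g(1)] g ky H by (simp add: lcos_m_assoc)
    qed
    have T_im: "T ` O' = lcosets H"
    proof -
      have "T ` O' = T ` (\<lambda>g. snd X g x) ` carrier G"
        by (rule arg_cong) (auto simp: O'_def orbit_def)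
      also have "\<dots> = (\<lambda>g. g <# H) ` carrier G"
        unfolding image_image by (rule image_cong) (auto simp: T)
      finally show ?thesis
        by (auto simp: LCOSETS_def)
    qed
    have T_inj: "inj_on T O'"
      by (rule inj_onI) (auto simp: T_def O'_def orbit_def)
    define f where "f y = (if y \<in> O' then Inl (T y) else Inr y)" for y
    have "bij_betw f (fst X) (lcosets H <+> (fst X - O'))"
    proof -
      have "inj_on f (fst X)"
        using T_inj by (auto simp: inj_on_def f_def)
      moreover have "f ` fst X = lcosets H <+> (fst X - O')"
        unfolding T_im[symmetric] using O_sub by (force simp: f_def image_iff)
      ultimately show ?thesis
        by (simp add: bij_betw_def)
    qed
    moreover have "T y \<in> lcosets H" if "y \<in> O'" for y
      using T_im that by auto
    ultimately show ?thesis
      using O_cl act T_act O_sub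
      by (auto simp: gset_iso_def gset_sum_def gset_cosets_def X'_def gset_restrict_def f_def
          split: if_splits intro!: exI[of _ f])
  qed
  ultimately show ?thesis
    using that by (auto simp: H_def)
qed


section \<open>Sums over stabilizers\<close>

lemma stab_sum_cong:
  fixes w w' :: "'a set \<Rightarrow> real"
  assumes "finite_gset G X" "\<And>S. subgroup S G \<Longrightarrow> w S = w' S"
  shows "stab_sum G w X = stab_sum G w' X"
  unfolding stab_sum_def
  using assms group_action.stabilizer_subgroup by (intro sum.cong refl) (fastforce simp: finite_gset_def)

lemma stab_sum_iso:
  assumes "finite_gset G X" "gset_iso G X Y"
  shows "stab_sum G w X = stab_sum G w Y"
proof -
  obtain f where f: "bij_betw f (fst X) (fst Y)"
    "\<And>g x. g \<in> carrier G \<Longrightarrow> x \<in> fst X \<Longrightarrow> f (snd X g x) = snd Y g (f x)"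
    using assms(2) by (auto simp: gset_iso_def)
  have "stabilizer G (snd Y) (f x) = stabilizer G (snd X) x" if "x \<in> fst X" for x
  proof -
    have "snd Y g (f x) = f x \<longleftrightarrow> snd X g x = x" if "g \<in> carrier G" for g
      using f that \<open>x \<in> fst X\<close> assms(1)
      by (metis (no_types, lifting) bij_betw_inv_into_left finite_gset_iff)
    then show ?thesis
      by (auto simp: stabilizer_def)
  qed
  then show ?thesis
    unfolding stab_sum_def using f(1)
    by (simp add: sum.reindex_bij_betw[symmetric])
qed

lemma stab_sum_gset_empty [simp]: "stab_sum G w gset_empty = 0"
  by (simp add: stab_sum_def gset_empty_def)

lemma stab_sum_gset_sum:
  assumes "finite_gset G X" "finite_gset G Y"
  shows "stab_sum G w (gset_sum X Y) = stab_sum G w X + stab_sum G w Y"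
proof -
  have "stabilizer G (snd (gset_sum X Y)) (Inl x) = stabilizer G (snd X) x" if "x \<in> fst X" for x
    using that by (auto simp: stabilizer_def gset_sum_def)
  moreover have "stabilizer G (snd (gset_sum X Y)) (Inr y) = stabilizer G (snd Y) y" if "y \<in> fst Y" for y
    using that by (auto simp: stabilizer_def gset_sum_def)
  moreover have "finite (fst X)" "finite (fst Y)"
    using assms by (auto simp: finite_gset_def)
  moreover have "fst (gset_sum X Y) = fst X <+> fst Y"
    by (simp add: gset_sum_def)
  ultimately show ?thesis
    by (simp add: stab_sum_def sum.Plus)
qed

text \<open>The stabilizer of a pair is the intersection of two stabilizers, and the indicator of
  lying below an intersection factors. This is particular to the weights of marks, whereas
  additivity holds for every weight.\<close>

lemma mark_gset_prod:
  "mark G (gset_prod X Y) H = mark G X H * mark G Y H"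
proof -
  have "stabilizer G (snd (gset_prod X Y)) z =
      stabilizer G (snd X) (fst z) \<inter> stabilizer G (snd Y) (snd z)" if "z \<in> fst X \<times> fst Y" for z
    using that by (auto simp: stabilizer_def gset_prod_def)
  then have "mark G (gset_prod X Y) H = (\<Sum>z\<in>fst X \<times> fst Y.
      of_bool (H \<subseteq> stabilizer G (snd X) (fst z)) * of_bool (H \<subseteq> stabilizer G (snd Y) (snd z)))"
    by (auto simp: stab_sum_def gset_prod_def intro!: sum.cong)
  then show ?thesis
    by (simp add: stab_sum_def sum_product sum.cartesian_product case_prod_unfold)
qed

section \<open>Stabilizers in coset spaces\<close>

lemma stabilizer_gset_cosets:
  assumes "subgroup H G" "a \<in> carrier G"
  shows "stabilizer G (snd (gset_cosets G H)) (a <# H) = a <# H #> inv a"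
proof -
  have H: "H \<subseteq> carrier G"
    by (rule subgroup.subset[OF assms(1)])
  have C: "a <# H \<in> lcosets H"
    using assms by (auto simp: LCOSETS_def)
  have "g <# (a <# H) = a <# H \<longleftrightarrow> inv a \<otimes> g \<otimes> a \<in> H" if "g \<in> carrier G" for g
  proof -
    have "(g \<otimes> a) <# H = a <# H \<longleftrightarrow> g \<otimes> a \<in> a <# H"
      using l_repr_independence[OF _ _ assms(1)] lcos_self[OF _ assms(1)] assms(2) that
      by (metis m_closed)
    also have "\<dots> \<longleftrightarrow> inv a \<otimes> (g \<otimes> a) \<in> H"
      using subgroup.lcos_module_imp[OF assms(1) is_group] subgroup.lcos_module_rev[OF assms(1) is_group]
        assms(2) that by blast
    finally show ?thesis
      using H assms that by (simp add: lcos_m_assoc m_assoc)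
  qed
  then have "g \<in> stabilizer G (snd (gset_cosets G H)) (a <# H) \<longleftrightarrow> g \<in> a <# H #> inv a" for g
    using C conj_mem_iff[OF H assms(2)] by (simp add: stabilizer_def gset_cosets_def) metis
  then show ?thesis
    by blast
qed

text \<open>The stabilizers are the conjugates of \<open>H\<close>, so invariance of
  \<open>w\<close> matters only along these. The weight of a mark need not be a class function, but
  it qualifies whenever \<open>H\<close> is normal.\<close>

lemma stab_sum_gset_cosets:
  fixes w :: "'a set \<Rightarrow> real"
  assumes "subgroup H G" "\<And>g. g \<in> carrier G \<Longrightarrow> w (g <# H #> inv g) = w H"
  shows "stab_sum G w (gset_cosets G H) = card (lcosets H) * w H"
proof -
  have "stab_sum G w (gset_cosets G H) = (\<Sum>C\<in>lcosets H. w H)"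
    unfolding stab_sum_def
    using assms stabilizer_gset_cosets
    by (intro sum.cong) (auto simp: gset_cosets_def LCOSETS_def)
  then show ?thesis
    by simp
qed

lemma mark_eq_0_iff:
  assumes "finite_gset G X"
  shows "mark G X H = 0 \<longleftrightarrow> (\<forall>x\<in>fst X. \<not> H \<subseteq> stabilizer G (snd X) x)"
  using assms unfolding stab_sum_def
  by (subst sum_nonneg_eq_0_iff) (auto simp: finite_gset_def)

text \<open>Burnside's theorem: a finite \<open>G\<close>-set is determined by its marks. A point of \<open>X\<close> whose
  stabilizer is of maximal order has a counterpart in \<open>Y\<close> with the same stabilizer, so that
  isomorphic orbits can be removed from both sides.\<close>

theorem gset_iso_if_marks_eq:
  fixes X :: "('a, 'x) gset" and Y :: "('a, 'y) gset"
  assumes "finite (carrier G)" "finite_gset G X" "finite_gset G Y"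
    and "\<And>H. subgroup H G \<Longrightarrow> mark G X H = mark G Y H"
  shows "gset_iso G X Y"
  using assms(2-)
proof (induction "card (fst X)" arbitrary: X Y rule: less_induct)
  case less
  note X = less.prems(1) and Y = less.prems(2) and marks = less.prems(3)
  have stabX: "subgroup (stabilizer G (snd X) x) G" if "x \<in> fst X" for x
    using X that by (auto simp: finite_gset_def group_action.stabilizer_subgroup)
  have stabY: "subgroup (stabilizer G (snd Y) y) G" if "y \<in> fst Y" for y
    using Y that by (auto simp: finite_gset_def group_action.stabilizer_subgroup)
  have fixed: "(\<exists>x\<in>fst X. H \<subseteq> stabilizer G (snd X) x) \<longleftrightarrow>
      (\<exists>y\<in>fst Y. H \<subseteq> stabilizer G (snd Y) y)" if "subgroup H G" for H
    using marks[OF that] mark_eq_0_iff[OF X, of H] mark_eq_0_iff[OF Y, of H] by auto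
  show ?case
  proof (cases "fst X = {}")
    case True
    \<comment> \<open>The trivial subgroup fixes every point, so a point of \<open>Y\<close> would
      force one in \<open>X\<close>.\<close>
    have "fst Y = {}"
      using fixed[OF triv_subgroup] True subgroup.one_closed[OF stabY] by auto
    then show ?thesis
      using True by (auto simp: gset_iso_def bij_betw_def)
  next
    case False
    have finX: "finite (fst X)"
      using X by (simp add: finite_gset_def)
    define c where "c x = card (stabilizer G (snd X) x)" for x
    have "Max (c ` fst X) \<in> c ` fst X"
      using False finX by (intro Max_in) auto
    then obtain x where x: "x \<in> fst X" and "c x = Max (c ` fst X)"
      by auto
    then have max: "c z \<le> c x" if "z \<in> fst X" for z
      using that finX by simp
    define H where "H = stabilizer G (snd X) x"
    obtain y where y: "y \<in> fst Y" "H \<subseteq> stabilizer G (snd Y) y"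
      using fixed[OF stabX[OF x]] x unfolding H_def by blast
    obtain z where z: "z \<in> fst X" "stabilizer G (snd Y) y \<subseteq> stabilizer G (snd X) z"
      using fixed[OF stabY[OF y(1)]] y by blast
    have fin: "finite (stabilizer G (snd X) z)"
      using assms(1) finite_subset subgroup.subset stabX z(1) by metis
    \<comment> \<open>The stabilizer of \<open>y\<close> is caught between \<open>H\<close> and the
      stabilizer of \<open>z\<close>, whose order does not exceed that of \<open>H\<close>; so all
      three coincide.\<close>
    have "stabilizer G (snd Y) y = H"
    proof -
      have "card (stabilizer G (snd X) z) \<le> card H"
        using max[OF z(1)] by (simp add: c_def H_def)
      then have "H = stabilizer G (snd X) z"
        using y z fin by (intro card_seteq) auto
      then show ?thesis
        using y z by auto
    qed
    then obtain Y' :: "('a, 'y) gset" where Y': "finite_gset G Y'" "gset_iso G Y (gset_sum (gset_cosets G H) Y')"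
      using gset_decompose[OF Y y(1) assms(1)] by metis
    obtain X' :: "('a, 'x) gset" where X': "finite_gset G X'" "card (fst X') < card (fst X)"
        "gset_iso G X (gset_sum (gset_cosets G H) X')"
      using gset_decompose[OF X x assms(1)] unfolding H_def by metis
    have C: "finite_gset G (gset_cosets G H)"
      using finite_gset_cosets assms(1) stabX[OF x] by (simp add: H_def)
    have "mark G X' K = mark G Y' K" if "subgroup K G" for K
      using marks[OF that] stab_sum_iso[OF X X'(3)] stab_sum_iso[OF Y Y'(2)]
      by (simp add: stab_sum_gset_sum X' Y' C)
    then have "gset_iso G X' Y'"
      using less.hyps[OF X'(2) X'(1) Y'(1)] by blast
    then have "gset_iso G (gset_sum (gset_cosets G H) X') (gset_sum (gset_cosets G H) Y')"
      by (intro gset_iso_sum gset_iso_refl)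
    then show ?thesis
      by (rule gset_iso_trans[OF gset_iso_trans[OF X'(3)] gset_iso_sym[OF Y Y'(2)]])
  qed
qed

end


subsection \<open>The Burnside ring through marks\<close>

locale finite_group = group +
  assumes finite_carrier: "finite (carrier G)"
begin

lemma finite_subgroup: "subgroup H G \<Longrightarrow> finite H"
  using finite_carrier finite_subset subgroup.subset by blast

text \<open>The auxiliary summand \<open>Z\<close> of the Grothendieck relation contributes the same
  real number to both sides and cancels.\<close>

lemma stab_sum_gset_diff:
  assumes "finite_gset G X" "finite_gset G Y" "(A, B) \<in> gset_diff G X Y"
  shows "stab_sum G w A - stab_sum G w B = stab_sum G w X - stab_sum G w Y"
proof -
  obtain Z :: "('a, nat) gset" where Z: "finite_gset G Z"
      "gset_iso G (gset_sum (gset_sum A Y) Z) (gset_sum (gset_sum X B) Z)"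
    and fin: "finite_gset G A" "finite_gset G B"
    using assms(3) by (auto simp: gset_diff_def)
  have "stab_sum G w (gset_sum (gset_sum A Y) Z) = stab_sum G w (gset_sum (gset_sum X B) Z)"
    using Z fin assms by (intro stab_sum_iso finite_gset_sum)
  then show ?thesis
    using Z fin assms by (simp add: stab_sum_gset_sum finite_gset_sum)
qed

text \<open>Since marks determine a G-set, the auxiliary summand can be taken empty in the converse
  direction. Membership in a class becomes a set of equations between marks, and independence of
  representatives becomes arithmetic.\<close>

lemma gset_diff_mem_iff:
  assumes "finite_gset G X" "finite_gset G Y"
  shows "(A, B) \<in> gset_diff G X Y \<longleftrightarrow> finite_gset G A \<and> finite_gset G B \<and>
    (\<forall>H. subgroup H G \<longrightarrow> mark G A H - mark G B H = mark G X H - mark G Y H)" (is "_ \<longleftrightarrow> ?R")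
proof
  assume "(A, B) \<in> gset_diff G X Y"
  then show ?R
    using stab_sum_gset_diff[OF assms] by (auto simp: gset_diff_def)
next
  assume R: ?R
  have "gset_iso G (gset_sum (gset_sum A Y) gset_empty) (gset_sum (gset_sum X B) gset_empty)"
    using assms R
    by (intro gset_iso_if_marks_eq finite_gset_sum finite_gset_empty finite_carrier)
      (auto simp: stab_sum_gset_sum finite_gset_sum finite_gset_empty algebra_simps)
  then show "(A, B) \<in> gset_diff G X Y"
    using R finite_gset_empty unfolding gset_diff_def by blast
qed

lemma gset_diff_eqI:
  assumes "finite_gset G X" "finite_gset G Y" "finite_gset G X'" "finite_gset G Y'"
    and "\<And>H. subgroup H G \<Longrightarrow> mark G X H - mark G Y H = mark G X' H - mark G Y' H"
  shows "gset_diff G X Y = gset_diff G X' Y'"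
  using assms gset_diff_mem_iff[OF assms(1,2)] gset_diff_mem_iff[OF assms(3,4)] by auto

lemma gset_diff_closed:
  assumes X: "finite_gset G X" and Y: "finite_gset G Y"
  shows "gset_diff G X Y \<in> carrier (burnside_ring G)"
proof -
  obtain A :: "('a, nat) gset" where A: "finite_gset G A" "gset_iso G X A"
    using gset_nat_copy[OF X] by blast
  obtain B :: "('a, nat) gset" where B: "finite_gset G B" "gset_iso G Y B"
    using gset_nat_copy[OF Y] by blast
  have "gset_diff G X Y = gset_diff G A B"
    using stab_sum_iso[OF X A(2)] stab_sum_iso[OF Y B(2)] by (intro gset_diff_eqI X Y A B) simp
  then show ?thesis
    using A(1) B(1) unfolding burnside_ring_def partial_object.simps by blast
qed

lemma gset_class_closed: "finite_gset G X \<Longrightarrow> gset_class G X \<in> carrier (burnside_ring G)"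
  by (simp add: gset_class_def gset_diff_closed finite_gset_empty)

lemma burnside_cases:
  assumes "u \<in> carrier (burnside_ring G)"
  obtains A B :: "('a, nat) gset" where "finite_gset G A" "finite_gset G B"
    "u = gset_diff G A B" "(A, B) \<in> u"
  using assms by (auto simp: burnside_ring_def gset_diff_mem_iff)

lemma virt_sum_gset_diff:
  assumes "finite_gset G X" "finite_gset G Y"
  shows "virt_sum G w (gset_diff G X Y) = stab_sum G w X - stab_sum G w Y"
proof -
  obtain A B where "(A, B) \<in> gset_diff G X Y"
    by (rule burnside_cases[OF gset_diff_closed[OF assms]])
  then have "(SOME p. p \<in> gset_diff G X Y) \<in> gset_diff G X Y"
    by (rule someI)
  then show ?thesis
    using stab_sum_gset_diff[OF assms]
    by (auto simp: virt_sum_def split: prod.split)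
qed

lemma virt_sum_gset_class:
  "finite_gset G X \<Longrightarrow> virt_sum G w (gset_class G X) = stab_sum G w X"
  by (simp add: gset_class_def virt_sum_gset_diff finite_gset_empty)

lemma burnside_eqI:
  assumes "u \<in> carrier (burnside_ring G)" "v \<in> carrier (burnside_ring G)"
    and "\<And>H. subgroup H G \<Longrightarrow> vmark G u H = vmark G v H"
  shows "u = v"
proof -
  obtain A B :: "('a, nat) gset" where u: "finite_gset G A" "finite_gset G B" "u = gset_diff G A B"
    using burnside_cases[OF assms(1)] by metis
  obtain C D :: "('a, nat) gset" where v: "finite_gset G C" "finite_gset G D" "v = gset_diff G C D"
    using burnside_cases[OF assms(2)] by metis
  show ?thesis
    using assms(3) u(1,2) v(1,2) unfolding u(3) v(3)
    by (intro gset_diff_eqI) (auto simp: virt_sum_gset_diff)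
qed

section \<open>Dependence of \<open>virt_sum\<close> on the weight\<close>

lemma virt_sum_cong:
  fixes w w' :: "'a set \<Rightarrow> real"
  assumes "u \<in> carrier (burnside_ring G)" "\<And>S. subgroup S G \<Longrightarrow> w S = w' S"
  shows "virt_sum G w u = virt_sum G w' u"
proof -
  obtain A B :: "('a, nat) gset" where u: "finite_gset G A" "finite_gset G B" "u = gset_diff G A B"
    using burnside_cases[OF assms(1)] by metis
  then show ?thesis
    using stab_sum_cong[OF u(1) assms(2)] stab_sum_cong[OF u(2) assms(2)]
    by (simp add: virt_sum_gset_diff)
qed

lemma virt_sum_sum:
  assumes "u \<in> carrier (burnside_ring G)"
  shows "virt_sum G (\<lambda>S. \<Sum>i\<in>I. w i S) u = (\<Sum>i\<in>I. virt_sum G (w i) u)"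
proof -
  obtain A B :: "('a, nat) gset" where u: "finite_gset G A" "finite_gset G B" "u = gset_diff G A B"
    using burnside_cases[OF assms(1)] by metis
  have "stab_sum G (\<lambda>S. \<Sum>i\<in>I. w i S) X = (\<Sum>i\<in>I. stab_sum G (w i) X)" for X :: "('a, nat) gset"
    unfolding stab_sum_def by (rule sum.swap)
  then show ?thesis
    using u by (simp add: virt_sum_gset_diff sum_subtractf)
qed

lemma virt_sum_cmult:
  assumes "u \<in> carrier (burnside_ring G)"
  shows "virt_sum G (\<lambda>S. c * w S) u = c * virt_sum G w u"
proof -
  obtain A B :: "('a, nat) gset" where u: "finite_gset G A" "finite_gset G B" "u = gset_diff G A B"
    using burnside_cases[OF assms(1)] by metis
  then show ?thesis
    by (simp add: virt_sum_gset_diff stab_sum_def sum_distrib_left right_diff_distrib)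
qed

text \<open>Marks are counts read as reals; integrality is what leaves only the two signs as
  invertible values.\<close>

lemma vmark_Ints:
  assumes "u \<in> carrier (burnside_ring G)"
  shows "vmark G u H \<in> \<int>"
proof -
  obtain A B :: "('a, nat) gset" where u: "finite_gset G A" "finite_gset G B" "u = gset_diff G A B"
    using burnside_cases[OF assms(1)] by metis
  have "mark G X H \<in> \<int>" for X :: "('a, nat) gset"
    unfolding stab_sum_def by (intro Ints_sum) (simp add: of_bool_def)
  then show ?thesis
    using u by (simp add: virt_sum_gset_diff)
qed

section \<open>Ring operations and units on marks\<close>

lemma burnside_add_gset_diff:
  assumes "finite_gset G A" "finite_gset G B" "finite_gset G C" "finite_gset G D"
  shows "gset_diff G A B \<oplus>\<^bsub>burnside_ring G\<^esub> gset_diff G C D = gset_diff G (gset_sum A C) (gset_sum B D)"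
proof -
  have "gset_diff G (gset_sum A' C') (gset_sum B' D') = gset_diff G (gset_sum A C) (gset_sum B D)"
    if "(A', B') \<in> gset_diff G A B" "(C', D') \<in> gset_diff G C D" for A' B' C' D'
    using that assms unfolding gset_diff_mem_iff[OF assms(1,2)] gset_diff_mem_iff[OF assms(3,4)]
    by (intro gset_diff_eqI finite_gset_sum) (auto simp: stab_sum_gset_sum algebra_simps)
  moreover obtain A' B' where "(A', B') \<in> gset_diff G A B"
    by (rule burnside_cases[OF gset_diff_closed[OF assms(1,2)]])
  moreover obtain C' D' where "(C', D') \<in> gset_diff G C D"
    by (rule burnside_cases[OF gset_diff_closed[OF assms(3,4)]])
  ultimately show ?thesis
    unfolding burnside_ring_def ring.simps monoid.simps by (intro UN_const_pair)
qed

lemma burnside_mult_gset_diff: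
  assumes "finite_gset G A" "finite_gset G B" "finite_gset G C" "finite_gset G D"
  shows "gset_diff G A B \<otimes>\<^bsub>burnside_ring G\<^esub> gset_diff G C D =
    gset_diff G (gset_sum (gset_prod A C) (gset_prod B D)) (gset_sum (gset_prod A D) (gset_prod B C))"
    (is "_ = ?r A B C D")
proof -
  have "gset_diff G (gset_sum (gset_prod A' C') (gset_prod B' D'))
      (gset_sum (gset_prod A' D') (gset_prod B' C')) = ?r A B C D"
    if "(A', B') \<in> gset_diff G A B" "(C', D') \<in> gset_diff G C D" for A' B' C' D'
  proof (rule gset_diff_eqI)
    note m = that[unfolded gset_diff_mem_iff[OF assms(1,2)] gset_diff_mem_iff[OF assms(3,4)]]
    show "mark G (gset_sum (gset_prod A' C') (gset_prod B' D')) H -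
          mark G (gset_sum (gset_prod A' D') (gset_prod B' C')) H =
        mark G (gset_sum (gset_prod A C) (gset_prod B D)) H -
          mark G (gset_sum (gset_prod A D) (gset_prod B C)) H" if "subgroup H G" for H
    proof -
      \<comment> \<open>The formal product expands (a - b)(c - d), so its virtual mark depends on
        the representatives only through the two differences.\<close>
      have "(mark G A' H - mark G B' H) * (mark G C' H - mark G D' H) =
          (mark G A H - mark G B H) * (mark G C H - mark G D H)"
        using m that by simp
      then show ?thesis
        using m assms
        by (simp add: stab_sum_gset_sum finite_gset_prod mark_gset_prod algebra_simps)
    qed
  qed (use that assms in \<open>auto simp: gset_diff_mem_iff intro!: finite_gset_sum finite_gset_prod\<close>)
  moreover obtain A' B' where "(A', B') \<in> gset_diff G A B"
    by (rule burnside_cases[OF gset_diff_closed[OF assms(1,2)]])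
  moreover obtain C' D' where "(C', D') \<in> gset_diff G C D"
    by (rule burnside_cases[OF gset_diff_closed[OF assms(3,4)]])
  ultimately show ?thesis
    unfolding burnside_ring_def ring.simps monoid.simps by (intro UN_const_pair)
qed

lemma burnside_add:
  assumes "u \<in> carrier (burnside_ring G)" "v \<in> carrier (burnside_ring G)"
  shows "u \<oplus>\<^bsub>burnside_ring G\<^esub> v \<in> carrier (burnside_ring G)"
    and "virt_sum G w (u \<oplus>\<^bsub>burnside_ring G\<^esub> v) = virt_sum G w u + virt_sum G w v"
proof -
  obtain A B :: "('a, nat) gset" where u: "finite_gset G A" "finite_gset G B" "u = gset_diff G A B"
    using burnside_cases[OF assms(1)] by metis
  obtain C D :: "('a, nat) gset" where v: "finite_gset G C" "finite_gset G D" "v = gset_diff G C D"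
    using burnside_cases[OF assms(2)] by metis
  show "u \<oplus>\<^bsub>burnside_ring G\<^esub> v \<in> carrier (burnside_ring G)"
    using u v by (simp add: burnside_add_gset_diff gset_diff_closed finite_gset_sum)
  show "virt_sum G w (u \<oplus>\<^bsub>burnside_ring G\<^esub> v) = virt_sum G w u + virt_sum G w v"
    using u v by (simp add: burnside_add_gset_diff virt_sum_gset_diff finite_gset_sum stab_sum_gset_sum)
qed

lemma burnside_mult:
  assumes "u \<in> carrier (burnside_ring G)" "v \<in> carrier (burnside_ring G)"
  shows "u \<otimes>\<^bsub>burnside_ring G\<^esub> v \<in> carrier (burnside_ring G)"
    and "vmark G (u \<otimes>\<^bsub>burnside_ring G\<^esub> v) H = vmark G u H * vmark G v H"
proof -
  obtain A B :: "('a, nat) gset" where u: "finite_gset G A" "finite_gset G B" "u = gset_diff G A B"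
    using burnside_cases[OF assms(1)] by metis
  obtain C D :: "('a, nat) gset" where v: "finite_gset G C" "finite_gset G D" "v = gset_diff G C D"
    using burnside_cases[OF assms(2)] by metis
  show "u \<otimes>\<^bsub>burnside_ring G\<^esub> v \<in> carrier (burnside_ring G)"
    using u v by (simp add: burnside_mult_gset_diff gset_diff_closed finite_gset_sum finite_gset_prod)
  show "vmark G (u \<otimes>\<^bsub>burnside_ring G\<^esub> v) H = vmark G u H * vmark G v H"
    using u v
    by (simp add: burnside_mult_gset_diff virt_sum_gset_diff finite_gset_sum finite_gset_prod
        stab_sum_gset_sum mark_gset_prod algebra_simps)
qed

lemma burnside_one:
  shows "\<one>\<^bsub>burnside_ring G\<^esub> \<in> carrier (burnside_ring G)"
    and "virt_sum G w \<one>\<^bsub>burnside_ring G\<^esub> = w (carrier G)"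
proof -
  have G: "subgroup (carrier G) G"
    by (rule subgroup_self)
  note fin = finite_gset_cosets[OF finite_carrier G]
  have "carrier G \<noteq> {}"
    by auto
  then have "card (lcosets (carrier G)) = 1"
    using l_lagrange[OF finite_carrier G] finite_carrier by (simp add: order_def)
  moreover have "g <# carrier G #> inv g = carrier G" if "g \<in> carrier G" for g
    using conj_mem_iff[OF subset_refl that] that by blast
  ultimately have "stab_sum G w (gset_cosets G (carrier G)) = w (carrier G)"
    using stab_sum_gset_cosets[OF G, of w] by simp
  then show "\<one>\<^bsub>burnside_ring G\<^esub> \<in> carrier (burnside_ring G)"
      "virt_sum G w \<one>\<^bsub>burnside_ring G\<^esub> = w (carrier G)"
    using fin virt_sum_gset_class[OF fin] gset_class_closed[OF fin]
    by (simp_all add: burnside_ring_def)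
qed

lemma burnside_unit_square:
  assumes "u \<in> carrier (burnside_ring G)"
    and "\<And>H. subgroup H G \<Longrightarrow> vmark G u H * vmark G u H = 1"
  shows "u \<otimes>\<^bsub>burnside_ring G\<^esub> u = \<one>\<^bsub>burnside_ring G\<^esub>" and "u \<in> Units (burnside_ring G)"
proof -
  show "u \<otimes>\<^bsub>burnside_ring G\<^esub> u = \<one>\<^bsub>burnside_ring G\<^esub>"
    using assms by (intro burnside_eqI burnside_mult burnside_one)
      (auto simp: burnside_mult burnside_one subgroup.subset)
  then show "u \<in> Units (burnside_ring G)"
    using assms(1) by (auto simp: Units_def)
qed

text \<open>The range is all subsets of the carrier, not only subgroups, so that it covers the sets
  \<open>insert g M\<close>.\<close>

lemma burnside_Units_iff:
  "u \<in> Units (burnside_ring G) \<longleftrightarrow> u \<in> carrier (burnside_ring G) \<and>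
     (\<forall>H\<subseteq>carrier G. vmark G u H * vmark G u H = 1)"
proof
  assume "u \<in> Units (burnside_ring G)"
  then obtain v where u: "u \<in> carrier (burnside_ring G)" and v: "v \<in> carrier (burnside_ring G)"
    and uv: "v \<otimes>\<^bsub>burnside_ring G\<^esub> u = \<one>\<^bsub>burnside_ring G\<^esub>"
    by (auto simp: Units_def)
  have "vmark G u H * vmark G u H = 1" if "H \<subseteq> carrier G" for H
  proof -
    have "vmark G v H * vmark G u H = 1"
      using burnside_mult(2)[OF v u, of H] uv burnside_one(2) that by simp
    moreover obtain i j :: int where "vmark G v H = of_int i" "vmark G u H = of_int j"
      using vmark_Ints u v by (metis Ints_cases)
    ultimately have "i * j = 1" "vmark G u H = of_int j"
      by (simp_all flip: of_int_mult)
    then show ?thesis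
      using pos_zmult_eq_1_iff_lemma[of i j] by (auto simp: zmult_eq_1_iff)
  qed
  then show "u \<in> carrier (burnside_ring G) \<and> (\<forall>H\<subseteq>carrier G. vmark G u H * vmark G u H = 1)"
    using u by blast
next
  assume u: "u \<in> carrier (burnside_ring G) \<and> (\<forall>H\<subseteq>carrier G. vmark G u H * vmark G u H = 1)"
  then show "u \<in> Units (burnside_ring G)"
    by (intro burnside_unit_square) (auto simp: subgroup.subset)
qed


subsection \<open>Core-trivial units through marks\<close>

text \<open>Both sides equal |G : core H| if \<open>K\<close> lies in \<open>core G H\<close> and 0
  otherwise. The left weight is constant on the conjugates of \<open>H\<close>; on the right the
  only stabilizer is the normal subgroup \<open>core G H\<close>.\<close>

lemma core_weight_gset_cosets:
  assumes H: "subgroup H G"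
  shows "stab_sum G (core_weight G K) (gset_cosets G H) = mark G (gset_cosets G (core G H)) K"
proof -
  note HG = subgroup.subset[OF H]
  note M = normal_core[OF H]
  note M' = normal_imp_subgroup[OF M]
  have pos: "card (core G H) > 0"
    using finite_subgroup[OF M'] subgroup.one_closed[OF M'] card_gt_0_iff by blast
  have "stab_sum G (core_weight G K) (gset_cosets G H) = card (lcosets H) * core_weight G K H"
    by (rule stab_sum_gset_cosets[OF H]) (simp add: core_index_def core_conj card_conj HG)
  also have "\<dots> = of_bool (K \<subseteq> core G H) * real (order G) / card (core G H)"
    using l_lagrange[OF finite_carrier H] by (simp add: core_index_def flip: of_nat_mult)
  also have "\<dots> = card (lcosets (core G H)) * (of_bool (K \<subseteq> core G H) :: real)"
    using l_lagrange[OF finite_carrier M'] pos by (simp add: field_simps flip: of_nat_mult)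
  also have "\<dots> = mark G (gset_cosets G (core G H)) K"
    by (rule stab_sum_gset_cosets[OF M', where w = "\<lambda>S. of_bool (K \<subseteq> S)", symmetric])
      (simp add: normal_conj[OF M])
  finally show ?thesis .
qed

text \<open>The base case ranges over all G-sets with empty carrier: outside the group the action
  function is arbitrary, so the empty G-set is not unique as a pair.\<close>

lemma gset_induct [consumes 1, case_names empty step]:
  fixes X :: "('a, 'x) gset"
  assumes "finite_gset G X"
    and empty: "\<And>X :: ('a, 'x) gset. finite_gset G X \<Longrightarrow> fst X = {} \<Longrightarrow> P X"
    and step: "\<And>H (X :: ('a, 'x) gset) X'. \<lbrakk>subgroup H G; finite_gset G X; finite_gset G X';
      gset_iso G X (gset_sum (gset_cosets G H) X'); P X'\<rbrakk> \<Longrightarrow> P X"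
  shows "P X"
  using assms(1)
proof (induction "card (fst X)" arbitrary: X rule: less_induct)
  case less
  show ?case
  proof (cases "fst X = {}")
    case False
    then obtain x where x: "x \<in> fst X"
      by blast
    obtain X' :: "('a, 'x) gset" where X': "finite_gset G X'" "card (fst X') < card (fst X)"
        "gset_iso G X (gset_sum (gset_cosets G (stabilizer G (snd X) x)) X')"
      using gset_decompose[OF less.prems x finite_carrier] by metis
    have "subgroup (stabilizer G (snd X) x) G"
      using less.prems x by (auto simp: finite_gset_def group_action.stabilizer_subgroup)
    then show ?thesis
      using step[OF _ less.prems X'(1,3) less.hyps[OF X'(2,1)]] by blast
  qed (use empty less.prems in blast)
qed

lemma stab_sum_decompose:
  assumes "subgroup H G" "finite_gset G X" "finite_gset G X'"
    "gset_iso G X (gset_sum (gset_cosets G H) X')"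
  shows "stab_sum G w X = stab_sum G w (gset_cosets G H) + stab_sum G w X'"
  using assms stab_sum_iso[OF assms(2,4)] by (simp add: stab_sum_gset_sum finite_gset_cosets finite_carrier)

text \<open>Replaces each orbit G/H by G/core H. Describing the result by its marks keeps the chosen
  decomposition into orbits out of the statement.\<close>

lemma ex_core_gset:
  assumes "finite_gset G X"
  shows "\<exists>Y :: ('a, nat) gset. finite_gset G Y \<and> (\<forall>K. mark G Y K = stab_sum G (core_weight G K) X)"
  using assms
proof (induction X rule: gset_induct)
  case (empty X)
  then show ?case
    using finite_gset_empty by (intro exI[of _ gset_empty]) (simp add: stab_sum_def[of _ _ X])
next
  case (step H X X')
  then obtain Y' :: "('a, nat) gset" where Y': "finite_gset G Y'"
      "\<And>K. mark G Y' K = stab_sum G (core_weight G K) X'"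
    by blast
  define C where "C = gset_cosets G (core G H)"
  have C: "finite_gset G C"
    unfolding C_def by (intro finite_gset_cosets finite_carrier normal_imp_subgroup normal_core step)
  obtain Y :: "('a, nat) gset" where Y: "finite_gset G Y" "gset_iso G (gset_sum C Y') Y"
    using gset_nat_copy[OF finite_gset_sum[OF C Y'(1)]] by metis
  have "mark G Y K = stab_sum G (core_weight G K) X" for K
    using stab_sum_iso[OF finite_gset_sum[OF C Y'(1)] Y(2), symmetric] stab_sum_decompose[OF step(1-4)] C Y'
      core_weight_gset_cosets[OF step(1)]
    by (simp add: stab_sum_gset_sum C_def)
  then show ?case
    using Y by blast
qed

lemma ex_core_burnside:
  assumes "u \<in> carrier (burnside_ring G)"
  shows "\<exists>v\<in>carrier (burnside_ring G). \<forall>K. vmark G v K = virt_sum G (core_weight G K) u"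
proof -
  obtain A B :: "('a, nat) gset" where u: "finite_gset G A" "finite_gset G B" "u = gset_diff G A B"
    using burnside_cases[OF assms(1)] by metis
  obtain C :: "('a, nat) gset" where C: "finite_gset G C"
      "\<And>K. mark G C K = stab_sum G (core_weight G K) A"
    using ex_core_gset[OF u(1)] by blast
  obtain D :: "('a, nat) gset" where D: "finite_gset G D"
      "\<And>K. mark G D K = stab_sum G (core_weight G K) B"
    using ex_core_gset[OF u(2)] by blast
  show ?thesis
    using u C D by (intro bexI[of _ "gset_diff G C D"]) (auto simp: virt_sum_gset_diff gset_diff_closed)
qed

text \<open>The uniqueness half for \<open>burnside_n\<close>: additivity and the values on coset
  spaces force all marks of \<open>f u\<close>, by splitting off orbits.\<close>

lemma vmark_core_hom:
  assumes f: "f \<in> hom (add_monoid (burnside_ring G)) (add_monoid (burnside_ring G))"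
    and f_core: "\<And>H. subgroup H G \<Longrightarrow>
      f (gset_class G (gset_cosets G H)) = gset_class G (gset_cosets G (core G H))"
    and u: "u \<in> carrier (burnside_ring G)"
  shows "f u \<in> carrier (burnside_ring G)"
    and "vmark G (f u) K = virt_sum G (core_weight G K) u"
proof -
  have f_closed: "f v \<in> carrier (burnside_ring G)" if "v \<in> carrier (burnside_ring G)" for v
    using f that by (auto simp: hom_def)
  have f_add: "vmark G (f (v \<oplus>\<^bsub>burnside_ring G\<^esub> w)) K = vmark G (f v) K + vmark G (f w) K"
    if "v \<in> carrier (burnside_ring G)" "w \<in> carrier (burnside_ring G)" for v w
    using f that f_closed by (simp add: hom_def burnside_add)
  have f_class: "vmark G (f (gset_class G X)) K = stab_sum G (core_weight G K) X"
    if "finite_gset G X" for X :: "('a, nat) gset"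
    using that
  proof (induction X rule: gset_induct)
    case (empty X)
    note X = gset_class_closed[OF empty(1)]
    \<comment> \<open>\<open>f\<close> is only known to preserve sums; that it sends the class of an
      empty G-set to something with mark 0 is read off from this idempotence.\<close>
    have "gset_class G X \<oplus>\<^bsub>burnside_ring G\<^esub> gset_class G X = gset_class G X"
      using X empty by (intro burnside_eqI burnside_add)
        (auto simp: burnside_add virt_sum_gset_class stab_sum_def)
    then have "vmark G (f (gset_class G X)) K = 0"
      using f_add[OF X X] by simp
    then show ?case
      using empty by (simp add: stab_sum_def)
  next
    case (step H X X')
    note C = finite_gset_cosets[OF finite_carrier step(1)]
    note M = finite_gset_cosets[OF finite_carrier normal_imp_subgroup[OF normal_core[OF step(1)]]]
    have "gset_class G X = gset_class G (gset_cosets G H) \<oplus>\<^bsub>burnside_ring G\<^esub> gset_class G X'"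
      using step C stab_sum_decompose[OF step(1-4)]
      by (intro burnside_eqI burnside_add gset_class_closed)
        (auto simp: burnside_add gset_class_closed virt_sum_gset_class)
    then have "vmark G (f (gset_class G X)) K =
        vmark G (gset_class G (gset_cosets G (core G H))) K + stab_sum G (core_weight G K) X'"
      using f_add[OF gset_class_closed[OF C] gset_class_closed[OF step(3)]] step f_core by simp
    also have "\<dots> = stab_sum G (core_weight G K) X"
      using stab_sum_decompose[OF step(1-4)] core_weight_gset_cosets[OF step(1)] M
      by (simp add: virt_sum_gset_class)
    finally show ?case .
  qed
  obtain A B :: "('a, nat) gset" where AB: "finite_gset G A" "finite_gset G B" "u = gset_diff G A B"
    using burnside_cases[OF u] by metis
  \<comment> \<open>Moving [B] to the other side reduces the difference to classes of actual G-sets,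
    without additive inverses in the ring.\<close>
  have "u \<oplus>\<^bsub>burnside_ring G\<^esub> gset_class G B = gset_class G A"
    using AB u by (intro burnside_eqI burnside_add gset_class_closed)
      (auto simp: burnside_add gset_class_closed virt_sum_gset_class virt_sum_gset_diff)
  then have "vmark G (f u) K + vmark G (f (gset_class G B)) K = vmark G (f (gset_class G A)) K"
    using f_add[OF u gset_class_closed[OF AB(2)]] by simp
  then show "vmark G (f u) K = virt_sum G (core_weight G K) u"
    using AB f_class by (simp add: virt_sum_gset_diff)
  show "f u \<in> carrier (burnside_ring G)"
    using f_closed u .
qed

text \<open>Resolves the definite description: existence from \<open>ex_core_burnside\<close>,
  uniqueness from \<open>vmark_core_hom\<close>. From here on \<open>burnside_n\<close> is
  accessible through marks.\<close>

lemma burnside_n: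
  assumes "u \<in> carrier (burnside_ring G)"
  shows "burnside_n G u \<in> carrier (burnside_ring G)"
    and "vmark G (burnside_n G u) K = virt_sum G (core_weight G K) u"
proof -
  let ?R = "burnside_ring G"
  let ?n = "\<lambda>f. f \<in> extensional (carrier ?R) \<and> f \<in> hom (add_monoid ?R) (add_monoid ?R) \<and>
    (\<forall>H. subgroup H G \<longrightarrow>
      f (gset_class G (gset_cosets G H)) = gset_class G (gset_cosets G (core G H)))"
  have "\<forall>v\<in>carrier ?R. \<exists>w. w \<in> carrier ?R \<and> (\<forall>K. vmark G w K = virt_sum G (core_weight G K) v)"
    using ex_core_burnside by blast
  from bchoice[OF this] obtain f where f: "\<And>v. v \<in> carrier ?R \<Longrightarrow> f v \<in> carrier ?R"
      "\<And>v K. v \<in> carrier ?R \<Longrightarrow> vmark G (f v) K = virt_sum G (core_weight G K) v"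
    by blast
  have "?n (restrict f (carrier ?R))"
  proof (intro conjI allI impI)
    show "restrict f (carrier ?R) \<in> hom (add_monoid ?R) (add_monoid ?R)"
    proof (rule homI)
      fix v w assume "v \<in> carrier (add_monoid ?R)" "w \<in> carrier (add_monoid ?R)"
      then have vw: "v \<in> carrier ?R" "w \<in> carrier ?R"
        by auto
      \<comment> \<open>The values of \<open>f\<close> are chosen independently of each other, yet
        \<open>f\<close> is additive: its marks are additive, and they determine each value.\<close>
      have "f (v \<oplus>\<^bsub>?R\<^esub> w) = f v \<oplus>\<^bsub>?R\<^esub> f w"
        using vw f by (intro burnside_eqI) (auto simp: burnside_add)
      then show "restrict f (carrier ?R) (v \<otimes>\<^bsub>add_monoid ?R\<^esub> w) =
          restrict f (carrier ?R) v \<otimes>\<^bsub>add_monoid ?R\<^esub> restrict f (carrier ?R) w"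
        using vw by (simp add: burnside_add)
    qed (use f in auto)
    fix H assume H: "subgroup H G"
    note C = finite_gset_cosets[OF finite_carrier H]
    note M = finite_gset_cosets[OF finite_carrier normal_imp_subgroup[OF normal_core[OF H]]]
    have "f (gset_class G (gset_cosets G H)) = gset_class G (gset_cosets G (core G H))"
      using f C M core_weight_gset_cosets[OF H]
      by (intro burnside_eqI) (auto simp: gset_class_closed virt_sum_gset_class)
    then show "restrict f (carrier ?R) (gset_class G (gset_cosets G H)) =
        gset_class G (gset_cosets G (core G H))"
      using gset_class_closed[OF C] by simp
  qed auto
  moreover have "f' = restrict f (carrier ?R)" if "?n f'" for f'
  proof (rule extensionalityI[of _ "carrier ?R"])
    fix v assume v: "v \<in> carrier ?R"
    have "f' v = f v"
      using vmark_core_hom[of f', OF _ _ v] that f v by (intro burnside_eqI) auto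
    then show "f' v = restrict f (carrier ?R) v"
      using v by simp
  qed (use that in auto)
  ultimately have "burnside_n G = restrict f (carrier ?R)"
    unfolding burnside_n_def by (rule the_equality)
  then show "burnside_n G u \<in> carrier ?R" "vmark G (burnside_n G u) K = virt_sum G (core_weight G K) u"
    using f assms by auto
qed

text \<open>For normal \<open>M\<close>, the sum of the marks at the sets \<open>insert g M\<close> counts, by the orbit counting
  lemma, the orbits of \<open>G\<close> on the \<open>M\<close>-fixed points. So \<open>burnside_n G u = 1\<close> says that all these averages
  of signs are \<open>1\<close>.\<close>

lemma core_units_iff:
  "u \<in> core_units G \<longleftrightarrow> u \<in> Units (burnside_ring G) \<and>
     (\<forall>M. M \<lhd> G \<longrightarrow> (\<forall>g\<in>carrier G. vmark G u (insert g M) = 1))"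
proof (cases "u \<in> Units (burnside_ring G)")
  case True
  then have u: "u \<in> carrier (burnside_ring G)"
    by (simp add: Units_def)
  define F where "F = {M. M \<lhd> G}"
  define d where "d M S = of_bool (core G S = M) * core_index G S" for M S
  define D where "D M = virt_sum G (d M) u" for M
  have "F \<subseteq> Pow (carrier G)"
    using normal_subset by (auto simp: F_def)
  then have finF: "finite F"
    by (rule finite_subset) (simp add: finite_carrier)
  have GF: "carrier G \<in> F"
    using subgroup_self by (simp add: F_def normal_inv_iff)
  have "M \<subseteq> carrier G" if "M \<in> F" for M
    using that normal_subset by (simp add: F_def)
  note F = finF GF this
  have coreF: "core G S \<in> F" if "subgroup S G" for S
    using that normal_core by (simp add: F_def)
  have n: "virt_sum G (core_weight G K) u = (\<Sum>M\<in>F. of_bool (K \<subseteq> M) * D M)" for K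
  proof -
    have "core_weight G K S = (\<Sum>M\<in>F. of_bool (K \<subseteq> M) * d M S)" if "subgroup S G" for S
    proof -
      have "(\<Sum>M\<in>F. of_bool (K \<subseteq> M) * d M S) = (\<Sum>M\<in>F. if M = core G S then core_weight G K S else 0)"
        by (intro sum.cong) (auto simp: d_def)
      then show ?thesis
        using coreF[OF that] finF by simp
    qed
    then have "virt_sum G (core_weight G K) u = virt_sum G (\<lambda>S. \<Sum>M\<in>F. of_bool (K \<subseteq> M) * d M S) u"
      by (intro virt_sum_cong u)
    then show ?thesis
      using u by (simp add: virt_sum_sum virt_sum_cmult D_def)
  qed
  \<comment> \<open>The factor \<open>card M'\<close> turns |G : M'| into |G|, so every orbit counts
    equally. At a single \<open>S\<close> both sides are \<open>card S\<close> if \<open>M\<close>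
    lies in the core of \<open>S\<close>, and 0 otherwise.\<close>
  have s: "(\<Sum>g\<in>carrier G. vmark G u (insert g M)) = (\<Sum>M'\<in>F. of_bool (M \<subseteq> M') * (card M' * D M'))"
    if M: "M \<lhd> G" for M
  proof -
    have "(\<Sum>g\<in>carrier G. of_bool (insert g M \<subseteq> S)) = (\<Sum>M'\<in>F. of_bool (M \<subseteq> M') * (card M' * d M' S))"
      if S: "subgroup S G" for S
    proof -
      note SG = subgroup.subset[OF S]
      note C = normal_imp_subgroup[OF normal_core[OF S]]
      have pos: "card (core G S) > 0"
        using finite_subgroup[OF C] subgroup.one_closed[OF C] card_gt_0_iff by blast
      have "M \<subseteq> S \<longleftrightarrow> M \<subseteq> core G S"
        using subset_core[OF M _ SG] core_subset[OF SG] by blast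
      then have "(\<Sum>g\<in>carrier G. of_bool (insert g M \<subseteq> S)) =
          (\<Sum>g\<in>carrier G. of_bool (M \<subseteq> core G S) * (of_bool (g \<in> S) :: real))"
        by (intro sum.cong) auto
      also have "\<dots> = of_bool (M \<subseteq> core G S) * real (card S)"
        using SG finite_carrier by (simp add: sum_distrib_left[symmetric] Int_absorb1 of_bool_def
          sum.If_cases)
      also have "\<dots> = (\<Sum>M'\<in>F. if M' = core G S then of_bool (M \<subseteq> core G S) * real (card S) else 0)"
        using coreF[OF S] finF by simp
      also have "\<dots> = (\<Sum>M'\<in>F. of_bool (M \<subseteq> M') * (card M' * d M' S))"
        using pos by (intro sum.cong) (auto simp: d_def core_index_def)
      finally show ?thesis .
    qed
    then have "virt_sum G (\<lambda>S. \<Sum>g\<in>carrier G. of_bool (insert g M \<subseteq> S)) u =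
        virt_sum G (\<lambda>S. \<Sum>M'\<in>F. of_bool (M \<subseteq> M') * (card M' * d M' S)) u"
      by (intro virt_sum_cong u)
    then show ?thesis
      using u by (simp add: virt_sum_sum virt_sum_cmult D_def)
  qed
  have "burnside_n G u = \<one>\<^bsub>burnside_ring G\<^esub> \<longleftrightarrow>
      (\<forall>K. subgroup K G \<longrightarrow> virt_sum G (core_weight G K) u = 1)"
  proof
    assume "burnside_n G u = \<one>\<^bsub>burnside_ring G\<^esub>"
    then show "\<forall>K. subgroup K G \<longrightarrow> virt_sum G (core_weight G K) u = 1"
      using burnside_n(2)[OF u, symmetric] burnside_one(2) by (simp add: subgroup.subset)
  next
    assume "\<forall>K. subgroup K G \<longrightarrow> virt_sum G (core_weight G K) u = 1"
    then show "burnside_n G u = \<one>\<^bsub>burnside_ring G\<^esub>"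
      using burnside_n[OF u] burnside_one by (intro burnside_eqI) (auto simp: subgroup.subset)
  qed
  \<comment> \<open>Inversion uses the equations at normal \<open>K\<close>. Conversely, with only
    \<open>D (carrier G)\<close> left the value is 1 at every subgroup, since each lies in the whole
    group.\<close>
  also have "\<dots> \<longleftrightarrow> (\<forall>M\<in>F. D M = (if M = carrier G then 1 else 0))"
  proof
    assume "\<forall>K. subgroup K G \<longrightarrow> virt_sum G (core_weight G K) u = 1"
    then have "\<forall>M\<in>F. (\<Sum>M'\<in>F. of_bool (M \<subseteq> M') * D M') = 1"
      unfolding n by (simp add: F_def normal_imp_subgroup)
    then show "\<forall>M\<in>F. D M = (if M = carrier G then 1 else 0)"
      using superset_sum_const_iff[OF F, of D 1] by blast
  next
    assume D: "\<forall>M\<in>F. D M = (if M = carrier G then 1 else 0)"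
    show "\<forall>K. subgroup K G \<longrightarrow> virt_sum G (core_weight G K) u = 1"
    proof (intro allI impI)
      fix K assume K: "subgroup K G"
      have "(\<Sum>M\<in>F. of_bool (K \<subseteq> M) * D M) = (\<Sum>M\<in>F. if M = carrier G then 1 else 0)"
        using D subgroup.subset[OF K] by (intro sum.cong) auto
      then show "virt_sum G (core_weight G K) u = 1"
        using finF GF by (simp add: n)
    qed
  qed
  \<comment> \<open>Passage between the two triangular systems: rescaling by the positive
    \<open>card M\<close> preserves zeros and turns the 1 at the whole group into
    \<open>order G\<close>.\<close>
  also have "\<dots> \<longleftrightarrow> (\<forall>M\<in>F. card M * D M = (if M = carrier G then real (order G) else 0))"
  proof (intro ball_cong refl)
    fix M assume "M \<in> F"
    then have M: "subgroup M G"
      by (simp add: F_def normal_imp_subgroup)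
    then have "card M > 0"
      using finite_subgroup[OF M] subgroup.one_closed[OF M] card_gt_0_iff by blast
    then show "D M = (if M = carrier G then 1 else 0) \<longleftrightarrow>
        card M * D M = (if M = carrier G then real (order G) else 0)"
      by (auto simp: order_def)
  qed
  also have "\<dots> \<longleftrightarrow> (\<forall>M\<in>F. (\<Sum>g\<in>carrier G. vmark G u (insert g M)) = order G)"
    using superset_sum_const_iff[OF F, of "\<lambda>M. card M * D M" "order G"] s by (simp add: F_def)
  also have "\<dots> \<longleftrightarrow> (\<forall>M\<in>F. \<forall>g\<in>carrier G. vmark G u (insert g M) = 1)"
  proof (intro ball_cong refl)
    fix M assume "M \<in> F"
    then have M: "M \<subseteq> carrier G"
      using normal_subset by (simp add: F_def)
    have le: "vmark G u (insert g M) \<le> 1" if "g \<in> carrier G" for g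
    proof -
      have "insert g M \<subseteq> carrier G"
        using M that by simp
      then have "vmark G u (insert g M) ^ 2 = 1"
        using True burnside_Units_iff unfolding power2_eq_square by blast
      then show ?thesis
        by (auto simp: power2_eq_1_iff)
    qed
    have "(\<Sum>g\<in>carrier G. vmark G u (insert g M)) = order G \<longleftrightarrow>
        (\<Sum>g\<in>carrier G. 1 - vmark G u (insert g M)) = 0"
      by (auto simp: sum_subtractf order_def)
    also have "\<dots> \<longleftrightarrow> (\<forall>g\<in>carrier G. vmark G u (insert g M) = 1)"
      using le finite_carrier by (subst sum_nonneg_eq_0_iff) auto
    finally show "(\<Sum>g\<in>carrier G. vmark G u (insert g M)) = order G \<longleftrightarrow>
        (\<forall>g\<in>carrier G. vmark G u (insert g M) = 1)" .
  qed
  finally show ?thesis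
    using True by (auto simp: core_units_def units_of_carrier F_def)
qed (simp add: core_units_def units_of_carrier)

end


subsection \<open>Inflation and fixed points\<close>

locale finite_group_normal = normal N G + finite_group G for N and G (structure)
begin

lemma carrier_quotient: "carrier (G Mod N) = (\<lambda>g. N #> g) ` carrier G"
  by (rule carrier_FactGroup)

lemma quotient_mult:
  "g \<in> carrier G \<Longrightarrow> h \<in> carrier G \<Longrightarrow> (N #> g) \<otimes>\<^bsub>G Mod N\<^esub> (N #> h) = N #> (g \<otimes> h)"
  by (simp add: rcos_sum)

lemma quotient_inv: "g \<in> carrier G \<Longrightarrow> inv\<^bsub>G Mod N\<^esub> (N #> g) = N #> inv g"
  by (simp add: inv_FactGroup carrier_quotient rcos_inv)

sublocale Q: finite_group "G Mod N"
  by (intro finite_group.intro factorgroup_is_group finite_group_axioms.intro)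
    (simp add: carrier_quotient finite_carrier)

lemma finite_gset_inf:
  assumes "finite_gset (G Mod N) X"
  shows "finite_gset G (gset_inf G N X)"
  using assms unfolding finite_gset_iff Q.finite_gset_iff
  by (simp add: gset_inf_def carrier_quotient rcos_sum[symmetric] subset)

lemma mark_gset_inf:
  assumes "H \<subseteq> carrier G"
  shows "mark G (gset_inf G N X) H = mark (G Mod N) X ((\<lambda>g. N #> g) ` H)"
proof -
  have "H \<subseteq> stabilizer G (snd (gset_inf G N X)) x \<longleftrightarrow>
      (\<lambda>g. N #> g) ` H \<subseteq> stabilizer (G Mod N) (snd X) x" for x
    using assms by (auto simp: stabilizer_def gset_inf_def carrier_quotient)
  moreover have "fst (gset_inf G N X) = fst X"
    by (simp add: gset_inf_def)
  ultimately show ?thesis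
    by (simp add: stab_sum_def)
qed

lemma fst_gset_fix: "fst (gset_fix N X) = {x \<in> fst X. \<forall>n\<in>N. snd X n x = x}"
  by (simp add: gset_fix_def Let_def)

lemma gset_fix_act:
  assumes X: "finite_gset G X" and x: "x \<in> fst (gset_fix N X)" and g: "g \<in> carrier G"
  shows "snd X g x \<in> fst (gset_fix N X)" "snd (gset_fix N X) (N #> g) x = snd X g x"
proof -
  have xX: "x \<in> fst X" and fixed: "\<And>n. n \<in> N \<Longrightarrow> snd X n x = x"
    using x by (auto simp: fst_gset_fix)
  have act: "snd X (h \<otimes> k) x = snd X h (snd X k x)" if "h \<in> carrier G" "k \<in> carrier G" for h k
    using X xX that by (auto simp: finite_gset_iff)
  have n_fix: "snd X n (snd X g x) = snd X g x" if n: "n \<in> N" for n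
  proof -
    \<comment> \<open>Normality lets \<open>n\<close> pass to the right of \<open>g\<close>, where
      its conjugate fixes \<open>x\<close>.\<close>
    have "n \<otimes> g = g \<otimes> (inv g \<otimes> n \<otimes> g)"
      using n g by (simp add: m_assoc) (simp add: m_assoc[symmetric])
    moreover have "inv g \<otimes> n \<otimes> g \<in> N"
      using n g by (rule inv_op_closed1[rotated])
    ultimately show ?thesis
      using act[of n g] act[of g "inv g \<otimes> n \<otimes> g"] fixed n g by simp
  qed
  then show "snd X g x \<in> fst (gset_fix N X)"
    using X xX g by (auto simp: fst_gset_fix finite_gset_iff)
  \<comment> \<open>In a right coset the chosen representative is \<open>n \<otimes> g\<close>.
    There \<open>n\<close> acts last, on the image of \<open>x\<close> under \<open>g\<close>, which
    is again fixed by \<open>N\<close>.\<close>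
  have "(SOME h. h \<in> N #> g) \<in> N #> g"
    using rcos_self[OF g subgroup_axioms] by (rule someI)
  then obtain n where "n \<in> N" "(SOME h. h \<in> N #> g) = n \<otimes> g"
    by (auto simp: r_coset_def)
  then show "snd (gset_fix N X) (N #> g) x = snd X g x"
    using act n_fix g xX fixed by (simp add: gset_fix_def Let_def)
qed

lemma finite_gset_fix:
  assumes X: "finite_gset G X"
  shows "finite_gset (G Mod N) (gset_fix N X)"
  unfolding Q.finite_gset_iff
proof (intro conjI ballI)
  show "finite (fst (gset_fix N X))"
    using X by (simp add: fst_gset_fix finite_gset_def)
  show "snd (gset_fix N X) C \<in> extensional (fst (gset_fix N X))" for C
    by (simp add: gset_fix_def Let_def)
  fix x assume x: "x \<in> fst (gset_fix N X)"
  have "snd X \<one> x = x"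
    using X x by (simp add: finite_gset_iff fst_gset_fix)
  then show "snd (gset_fix N X) \<one>\<^bsub>G Mod N\<^esub> x = x"
    using gset_fix_act(2)[OF X x one_closed] by (simp add: subset)
  fix C assume "C \<in> carrier (G Mod N)"
  then obtain g where g: "g \<in> carrier G" "C = N #> g"
    by (auto simp: carrier_quotient)
  then show "snd (gset_fix N X) C x \<in> fst (gset_fix N X)"
    using gset_fix_act[OF X x] by simp
  fix D assume "D \<in> carrier (G Mod N)"
  then obtain h where h: "h \<in> carrier G" "D = N #> h"
    by (auto simp: carrier_quotient)
  have "snd X (g \<otimes> h) x = snd X g (snd X h x)"
    using X x g h by (simp add: finite_gset_iff fst_gset_fix)
  then show "snd (gset_fix N X) (C \<otimes>\<^bsub>G Mod N\<^esub> D) x =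
      snd (gset_fix N X) C (snd (gset_fix N X) D x)"
    using gset_fix_act[OF X x] gset_fix_act[OF X gset_fix_act(1)[OF X x h(1)] g(1)] g h
    by (simp only: quotient_mult m_closed)
qed

text \<open>As \<open>N \<in> L\<close>, a point fixed by \<open>\<Union>L\<close> is automatically
  fixed by \<open>N\<close>, so restricting to \<open>N\<close>-fixed points loses nothing.
  \<open>L\<close> may be any such set of cosets, which includes \<open>insert C M\<close> for a
  normal subgroup \<open>M\<close> of the quotient.\<close>

lemma mark_gset_fix:
  assumes X: "finite_gset G X" and L: "L \<subseteq> carrier (G Mod N)" "N \<in> L"
  shows "mark (G Mod N) (gset_fix N X) L = mark G X (\<Union>L)"
proof -
  have iff: "L \<subseteq> stabilizer (G Mod N) (snd (gset_fix N X)) x \<longleftrightarrow> \<Union>L \<subseteq> stabilizer G (snd X) x"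
    if x: "x \<in> fst (gset_fix N X)" for x
  proof -
    have "C \<in> stabilizer (G Mod N) (snd (gset_fix N X)) x \<longleftrightarrow> C \<subseteq> stabilizer G (snd X) x"
      if C: "C \<in> L" for C
    proof -
      have "C \<in> carrier (G Mod N)"
        using C L by blast
      then have "h \<in> carrier G \<and> C = N #> h" if "h \<in> C" for h
        using that repr_independence[OF _ _ subgroup_axioms] r_coset_subset_G[OF subset]
        by (auto simp: carrier_quotient subset_iff)
      then have act: "h \<in> carrier G" "snd (gset_fix N X) C x = snd X h x" if "h \<in> C" for h
        using that gset_fix_act(2)[OF X x] by metis+
      moreover have "C \<noteq> {}"
        using \<open>C \<in> carrier (G Mod N)\<close> rcos_self[OF _ subgroup_axioms] by (auto simp: carrier_quotient)
      ultimately show ?thesis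
        using \<open>C \<in> carrier (G Mod N)\<close> unfolding stabilizer_def by auto
    qed
    then show ?thesis
      by blast
  qed
  have "mark G X (\<Union>L) = (\<Sum>x\<in>fst (gset_fix N X). of_bool (\<Union>L \<subseteq> stabilizer G (snd X) x))"
    unfolding stab_sum_def
  proof (rule sum.mono_neutral_right)
    show "\<forall>x\<in>fst X - fst (gset_fix N X). of_bool (\<Union>L \<subseteq> stabilizer G (snd X) x) = (0 :: real)"
      using L(2) by (auto simp: fst_gset_fix stabilizer_def)
  qed (use X in \<open>auto simp: fst_gset_fix finite_gset_def\<close>)
  then show ?thesis
    using iff by (simp add: stab_sum_def)
qed

lemma subgroup_quotient:
  assumes "subgroup L (G Mod N)"
  shows "L \<subseteq> carrier (G Mod N)" "N \<in> L"
  using subgroup.subset[OF assms] subgroup.one_closed[OF assms] by simp_all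

lemma burnside_inf_gset_diff:
  assumes A: "finite_gset (G Mod N) A" and B: "finite_gset (G Mod N) B"
  shows "burnside_inf G N (gset_diff (G Mod N) A B) = gset_diff G (gset_inf G N A) (gset_inf G N B)"
proof -
  \<comment> \<open>Two representatives over the quotient are known to agree only at subgroups, so
    the image of \<open>H\<close> has to be one.\<close>
  have img: "subgroup ((\<lambda>g. N #> g) ` H) (G Mod N)" if "subgroup H G" for H
    using that r_coset_hom_Mod Q.is_group is_group
    by (intro group_hom.subgroup_img_is_subgroup[OF group_hom.intro]) (auto simp: group_hom_axioms_def)
  have "gset_diff G (gset_inf G N A') (gset_inf G N B') = gset_diff G (gset_inf G N A) (gset_inf G N B)"
    if "(A', B') \<in> gset_diff (G Mod N) A B" for A' B'
    using that[unfolded Q.gset_diff_mem_iff[OF A B]] A B img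
    by (intro gset_diff_eqI finite_gset_inf) (auto simp: mark_gset_inf subgroup.subset)
  moreover obtain A' B' where "(A', B') \<in> gset_diff (G Mod N) A B"
    by (rule Q.burnside_cases[OF Q.gset_diff_closed[OF A B]])
  ultimately show ?thesis
    unfolding burnside_inf_def by (rule UN_const_pair)
qed

text \<open>The union of a set of cosets is its preimage under the projection; this is the
  correspondence between subsets of the quotient and subsets of \<open>G\<close> saturated under
  \<open>N\<close>.\<close>

lemma mem_Union_quotient:
  assumes "L \<subseteq> carrier (G Mod N)"
  shows "x \<in> \<Union>L \<longleftrightarrow> x \<in> carrier G \<and> N #> x \<in> L"
proof
  assume "x \<in> \<Union>L"
  then obtain g where g: "g \<in> carrier G" "N #> g \<in> L" "x \<in> N #> g"
    using assms by (auto simp: carrier_quotient)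
  then have "N #> x = N #> g"
    using repr_independence[OF _ _ subgroup_axioms] by metis
  then show "x \<in> carrier G \<and> N #> x \<in> L"
    using g r_coset_subset_G[OF subset] by auto
next
  assume "x \<in> carrier G \<and> N #> x \<in> L"
  then show "x \<in> \<Union>L"
    using rcos_self[OF _ subgroup_axioms] by blast
qed

lemma subgroup_Union_quotient:
  assumes L: "subgroup L (G Mod N)"
  shows "subgroup (\<Union>L) G"
proof (rule subgroupI)
  note mem = mem_Union_quotient[OF subgroup.subset[OF L]]
  show "\<Union>L \<subseteq> carrier G"
    using mem by blast
  show "\<Union>L \<noteq> {}"
    using subgroup_quotient(2)[OF L] subgroup.one_closed[OF subgroup_axioms] by blast
  show "inv a \<in> \<Union>L" if "a \<in> \<Union>L" for a
    using that subgroup.m_inv_closed[OF L] quotient_inv inv_closed unfolding mem by metis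
  show "a \<otimes> b \<in> \<Union>L" if "a \<in> \<Union>L" "b \<in> \<Union>L" for a b
    using that subgroup.m_closed[OF L] quotient_mult m_closed unfolding mem by metis
qed

lemma normal_Union_quotient:
  assumes M: "M \<lhd> G Mod N"
  shows "\<Union>M \<lhd> G"
proof -
  note M' = normal_imp_subgroup[OF M]
  note mem = mem_Union_quotient[OF subgroup.subset[OF M']]
  have "x \<otimes> h \<otimes> inv x \<in> \<Union>M" if "x \<in> carrier G" "h \<in> \<Union>M" for x h
  proof -
    have "(N #> x) \<otimes>\<^bsub>G Mod N\<^esub> (N #> h) \<otimes>\<^bsub>G Mod N\<^esub> inv\<^bsub>G Mod N\<^esub> (N #> x) \<in> M"
      using that mem by (intro normal.inv_op_closed2[OF M]) (auto simp: carrier_quotient)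
    then show ?thesis
      using that unfolding mem
      by (auto simp: inv_FactGroup carrier_quotient rcos_inv rcos_sum)
  qed
  then show ?thesis
    using subgroup_Union_quotient[OF M'] by (simp add: normal_inv_iff)
qed

lemma normal_image_quotient:
  assumes "M \<lhd> G"
  shows "(\<lambda>g. N #> g) ` M \<lhd> G Mod N"
  using r_coset_hom_Mod Q.is_group is_group
  by (intro normal.surj_hom_normal_subgroup[OF assms] group_hom.intro)
    (auto simp: group_hom_axioms_def carrier_quotient)

lemma image_Union_quotient:
  assumes "L \<subseteq> carrier (G Mod N)"
  shows "(\<lambda>g. N #> g) ` \<Union>L = L"
proof (intro equalityI subsetI)
  fix C assume "C \<in> L"
  then obtain g where "g \<in> carrier G" "C = N #> g" "N #> g \<in> L"
    using assms by (auto simp: carrier_quotient)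
  then show "C \<in> (\<lambda>g. N #> g) ` \<Union>L"
    using mem_Union_quotient[OF assms] by blast
qed (use mem_Union_quotient[OF assms] in auto)

lemma burnside_fix_gset_diff:
  assumes A: "finite_gset G A" and B: "finite_gset G B"
  shows "burnside_fix G N (gset_diff G A B) = gset_diff (G Mod N) (gset_fix N A) (gset_fix N B)"
proof -
  have "gset_diff (G Mod N) (gset_fix N A') (gset_fix N B') = gset_diff (G Mod N) (gset_fix N A) (gset_fix N B)"
    if "(A', B') \<in> gset_diff G A B" for A' B'
    using that[unfolded gset_diff_mem_iff[OF A B]] A B subgroup_Union_quotient
    by (intro Q.gset_diff_eqI finite_gset_fix) (auto simp: mark_gset_fix subgroup_quotient)
  moreover obtain A' B' where "(A', B') \<in> gset_diff G A B"
    by (rule burnside_cases[OF gset_diff_closed[OF A B]])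
  ultimately show ?thesis
    unfolding burnside_fix_def by (rule UN_const_pair)
qed

lemma burnside_inf:
  assumes "v \<in> carrier (burnside_ring (G Mod N))"
  shows "burnside_inf G N v \<in> carrier (burnside_ring G)"
    and "H \<subseteq> carrier G \<Longrightarrow> vmark G (burnside_inf G N v) H = vmark (G Mod N) v ((\<lambda>g. N #> g) ` H)"
proof -
  obtain A B :: "('a set, nat) gset" where v: "finite_gset (G Mod N) A" "finite_gset (G Mod N) B"
      "v = gset_diff (G Mod N) A B"
    using Q.burnside_cases[OF assms] by metis
  show "burnside_inf G N v \<in> carrier (burnside_ring G)"
    using v by (simp add: burnside_inf_gset_diff gset_diff_closed finite_gset_inf)
  show "vmark G (burnside_inf G N v) H = vmark (G Mod N) v ((\<lambda>g. N #> g) ` H)" if "H \<subseteq> carrier G"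
    using v that
    by (simp add: burnside_inf_gset_diff virt_sum_gset_diff Q.virt_sum_gset_diff finite_gset_inf
        mark_gset_inf)
qed

lemma burnside_fix:
  assumes "u \<in> carrier (burnside_ring G)"
  shows "burnside_fix G N u \<in> carrier (burnside_ring (G Mod N))"
    and "L \<subseteq> carrier (G Mod N) \<Longrightarrow> N \<in> L \<Longrightarrow> vmark (G Mod N) (burnside_fix G N u) L = vmark G u (\<Union>L)"
proof -
  obtain A B :: "('a, nat) gset" where u: "finite_gset G A" "finite_gset G B" "u = gset_diff G A B"
    using burnside_cases[OF assms] by metis
  show "burnside_fix G N u \<in> carrier (burnside_ring (G Mod N))"
    using u by (simp add: burnside_fix_gset_diff Q.gset_diff_closed finite_gset_fix)
  show "vmark (G Mod N) (burnside_fix G N u) L = vmark G u (\<Union>L)"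
    if "L \<subseteq> carrier (G Mod N)" "N \<in> L"
    using u that
    by (simp add: burnside_fix_gset_diff virt_sum_gset_diff Q.virt_sum_gset_diff finite_gset_fix
        mark_gset_fix)
qed

text \<open>On marks, inflation evaluates at images and fixed points evaluate at preimages. The
  projection is surjective, so the image of the preimage of \<open>L\<close> is
  \<open>L\<close>.\<close>

lemma burnside_fix_inf:
  assumes "v \<in> carrier (burnside_ring (G Mod N))"
  shows "burnside_fix G N (burnside_inf G N v) = v"
proof (rule Q.burnside_eqI)
  fix L assume L: "subgroup L (G Mod N)"
  note LQ = subgroup_quotient[OF L]
  have "\<Union>L \<subseteq> carrier G"
    by (rule subgroup.subset[OF subgroup_Union_quotient[OF L]])
  then show "vmark (G Mod N) (burnside_fix G N (burnside_inf G N v)) L = vmark (G Mod N) v L"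
    by (simp only: burnside_fix(2)[OF burnside_inf(1)[OF assms] LQ] burnside_inf(2)[OF assms]
        image_Union_quotient[OF LQ(1)])
qed (use assms burnside_inf burnside_fix in auto)

text \<open>Taking fixed points reindexes marks along preimages, and marks multiply pointwise; the
  same argument with images serves inflation.\<close>

lemma burnside_fix_mult:
  assumes "u \<in> carrier (burnside_ring G)" "v \<in> carrier (burnside_ring G)"
  shows "burnside_fix G N (u \<otimes>\<^bsub>burnside_ring G\<^esub> v) =
    burnside_fix G N u \<otimes>\<^bsub>burnside_ring (G Mod N)\<^esub> burnside_fix G N v"
  using assms by (intro Q.burnside_eqI)
    (auto simp: burnside_fix burnside_mult Q.burnside_mult subgroup_quotient)

lemma burnside_inf_mult:
  assumes "u \<in> carrier (burnside_ring (G Mod N))" "v \<in> carrier (burnside_ring (G Mod N))"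
  shows "burnside_inf G N (u \<otimes>\<^bsub>burnside_ring (G Mod N)\<^esub> v) =
    burnside_inf G N u \<otimes>\<^bsub>burnside_ring G\<^esub> burnside_inf G N v"
  using assms by (intro burnside_eqI)
    (auto simp: burnside_inf burnside_mult Q.burnside_mult subgroup.subset)

section \<open>Core-trivial units under fixed points and inflation\<close>

lemma burnside_fix_core_units:
  assumes "u \<in> core_units G"
  shows "burnside_fix G N u \<in> core_units (G Mod N)"
proof -
  have U: "u \<in> Units (burnside_ring G)"
    and core: "\<And>M g. M \<lhd> G \<Longrightarrow> g \<in> carrier G \<Longrightarrow> vmark G u (insert g M) = 1"
    using assms by (auto simp: core_units_iff)
  then have u: "u \<in> carrier (burnside_ring G)"
    by (simp add: Units_def)
  have "burnside_fix G N u \<in> Units (burnside_ring (G Mod N))"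
  proof (rule Q.burnside_unit_square)
    fix L assume L: "subgroup L (G Mod N)"
    have "\<Union>L \<subseteq> carrier G"
      using subgroup_Union_quotient[OF L] by (rule subgroup.subset)
    then show "vmark (G Mod N) (burnside_fix G N u) L * vmark (G Mod N) (burnside_fix G N u) L = 1"
      using U unfolding burnside_fix(2)[OF u subgroup_quotient[OF L]] burnside_Units_iff by blast
  qed (rule burnside_fix(1)[OF u])
  moreover have "vmark (G Mod N) (burnside_fix G N u) (insert C M) = 1"
    if M: "M \<lhd> G Mod N" and C: "C \<in> carrier (G Mod N)" for M C
  proof -
    obtain g where g: "g \<in> carrier G" "C = N #> g"
      using C unfolding carrier_quotient by blast
    note MQ = subgroup_quotient[OF normal_imp_subgroup[OF M]]
    have "vmark (G Mod N) (burnside_fix G N u) (insert C M) = vmark G u (\<Union>(insert C M))"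
      using that MQ by (intro burnside_fix(2)[OF u]) auto
    \<comment> \<open>The two sets differ but generate the same subgroup: \<open>N\<close> lies in
      \<open>\<Union>M\<close>, so a subgroup containing \<open>g\<close> and
      \<open>\<Union>M\<close> contains the whole coset of \<open>g\<close>.\<close>
    also have "\<dots> = vmark G u (insert g (\<Union>M))"
    proof (rule virt_sum_cong[OF u])
      fix S assume S: "subgroup S G"
      have "C \<subseteq> S" if "g \<in> S" "\<Union>M \<subseteq> S"
        using that MQ(2) subgroup.m_closed[OF S] unfolding g(2) r_coset_def by blast
      moreover have "g \<in> C"
        using g rcos_self subgroup_axioms by simp
      ultimately have "\<Union>(insert C M) \<subseteq> S \<longleftrightarrow> insert g (\<Union>M) \<subseteq> S"
        by auto
      then show "of_bool (\<Union>(insert C M) \<subseteq> S) = (of_bool (insert g (\<Union>M) \<subseteq> S) :: real)"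
        by simp
    qed
    also have "\<dots> = 1"
      using core normal_Union_quotient[OF M] g by simp
    finally show ?thesis .
  qed
  ultimately show ?thesis
    by (simp add: Q.core_units_iff)
qed

text \<open>The projection is surjective, so it sends normal \<open>M\<close> to a normal subgroup,
  and the sets \<open>insert g M\<close> to sets of the same shape in the quotient.\<close>

lemma burnside_inf_core_units:
  assumes "v \<in> core_units (G Mod N)"
  shows "burnside_inf G N v \<in> core_units G"
proof -
  have U: "v \<in> Units (burnside_ring (G Mod N))"
    and core: "\<And>M C. M \<lhd> G Mod N \<Longrightarrow> C \<in> carrier (G Mod N) \<Longrightarrow> vmark (G Mod N) v (insert C M) = 1"
    using assms by (auto simp: Q.core_units_iff)
  then have v: "v \<in> carrier (burnside_ring (G Mod N))"
    by (simp add: Units_def)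
  have "vmark (G Mod N) v ((\<lambda>g. N #> g) ` H) * vmark (G Mod N) v ((\<lambda>g. N #> g) ` H) = 1"
    if "H \<subseteq> carrier G" for H
    by (rule U[unfolded Q.burnside_Units_iff carrier_quotient, THEN conjunct2, rule_format,
        OF image_mono[OF that]])
  then have "burnside_inf G N v \<in> Units (burnside_ring G)"
    by (simp add: burnside_Units_iff burnside_inf[OF v])
  moreover have "vmark G (burnside_inf G N v) (insert g M) = 1"
    if M: "M \<lhd> G" and g: "g \<in> carrier G" for M g
  proof -
    have "vmark G (burnside_inf G N v) (insert g M) =
        vmark (G Mod N) v (insert (N #> g) ((\<lambda>g. N #> g) ` M))"
      using burnside_inf(2)[OF v, of "insert g M"] g normal_subset[OF M] by simp
    then show ?thesis
      using core[OF normal_image_quotient[OF M]] g by (simp add: carrier_quotient)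
  qed
  ultimately show ?thesis
    by (simp add: core_units_iff)
qed

end

section \<open>Products of core-trivial units\<close>

lemma (in finite_group) core_unitsD:
  assumes "u \<in> core_units G"
  shows "u \<in> carrier (burnside_ring G)" "u \<in> Units (burnside_ring G)"
    and "H \<subseteq> carrier G \<Longrightarrow> vmark G u H * vmark G u H = 1"
    and "u \<otimes>\<^bsub>burnside_ring G\<^esub> u = \<one>\<^bsub>burnside_ring G\<^esub>"
proof -
  show U: "u \<in> Units (burnside_ring G)"
    using assms by (simp add: core_units_iff)
  then show "u \<in> carrier (burnside_ring G)" "H \<subseteq> carrier G \<Longrightarrow> vmark G u H * vmark G u H = 1"
    by (auto simp: burnside_Units_iff)
  show "u \<otimes>\<^bsub>burnside_ring G\<^esub> u = \<one>\<^bsub>burnside_ring G\<^esub>"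
    using U by (intro burnside_unit_square) (auto simp: burnside_Units_iff subgroup.subset)
qed

text \<open>Additivity of \<open>burnside_n\<close> says nothing about products; in the description
  by marks both conditions are visibly multiplicative.\<close>

lemma (in finite_group) core_units_mult:
  assumes "u \<in> core_units G" "v \<in> core_units G"
  shows "u \<otimes>\<^bsub>burnside_ring G\<^esub> v \<in> core_units G"
proof -
  note u = core_unitsD[OF assms(1)] and v = core_unitsD[OF assms(2)]
  have "vmark G (u \<otimes>\<^bsub>burnside_ring G\<^esub> v) H * vmark G (u \<otimes>\<^bsub>burnside_ring G\<^esub> v) H = 1"
    if "H \<subseteq> carrier G" for H
  proof -
    have "(vmark G u H * vmark G u H) * (vmark G v H * vmark G v H) = 1"
      using u(3) v(3) that by simp
    then show ?thesis
      using u v by (simp add: burnside_mult algebra_simps)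
  qed
  then have "u \<otimes>\<^bsub>burnside_ring G\<^esub> v \<in> Units (burnside_ring G)"
    using burnside_mult(1)[OF u(1) v(1)] by (simp add: burnside_Units_iff)
  moreover have "vmark G (u \<otimes>\<^bsub>burnside_ring G\<^esub> v) (insert g M) = 1" if "M \<lhd> G" "g \<in> carrier G" for M g
    using assms that unfolding burnside_mult(2)[OF u(1) v(1)] core_units_iff by auto
  ultimately show ?thesis
    unfolding core_units_iff by blast
qed

section \<open>The splitting of the group of core-trivial units\<close>

theorem corollary6p14:
  fixes G :: "('a, 'm) monoid_scheme" and N :: "'a set"
  assumes "group G" and "finite (carrier G)" and "N \<lhd> G"
  shows "(burnside_units G)\<lparr>carrier := core_units G\<rparr> \<cong>
    (burnside_units G)\<lparr>carrier := burnside_inf G N ` core_units (G Mod N)\<rparr> \<times>\<times>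
    (burnside_units G)\<lparr>carrier := core_units G \<inter>
       kernel (burnside_units G) (burnside_units (G Mod N)) (burnside_fix G N)\<rparr>"
proof -
  interpret finite_group_normal N G
    using assms by (simp add: finite_group_normal_def finite_group_def finite_group_axioms_def)
  let ?R = "burnside_ring G" and ?Q = "burnside_ring (G Mod N)"
  let ?I = "burnside_inf G N ` core_units (G Mod N)"
  let ?K = "core_units G \<inter> kernel (burnside_units G) (burnside_units (G Mod N)) (burnside_fix G N)"
  define p where "p u = burnside_inf G N (burnside_fix G N u)" for u
  have K_iff: "u \<in> ?K \<longleftrightarrow> u \<in> core_units G \<and> burnside_fix G N u = \<one>\<^bsub>?Q\<^esub>" for u
    using core_unitsD(2) by (auto simp: kernel_def units_of_carrier units_of_one)
  have p_core: "p u \<in> core_units G" if "u \<in> core_units G" for u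
    using that by (simp add: p_def burnside_inf_core_units burnside_fix_core_units)
  have p_mult: "p (u \<otimes>\<^bsub>?R\<^esub> v) = p u \<otimes>\<^bsub>?R\<^esub> p v" if "u \<in> core_units G" "v \<in> core_units G" for u v
    using that core_unitsD(1) by (simp add: p_def burnside_fix_mult burnside_inf_mult burnside_fix)
  have p_inf: "p a = a" if "a \<in> ?I" for a
    using that Q.core_unitsD(1) by (auto simp: p_def burnside_fix_inf)
  \<comment> \<open>Equations between products of core-trivial units are checked on marks, so
    associativity and commutativity are inherited from the reals.\<close>
  have eqI: "u = v" if "u \<in> core_units G" "v \<in> core_units G"
      "\<And>H. H \<subseteq> carrier G \<Longrightarrow> vmark G u H = vmark G v H" for u v
    using that core_unitsD(1) by (intro burnside_eqI) (auto simp: subgroup.subset)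
  note vm = burnside_mult(2)[OF core_unitsD(1) core_unitsD(1)]
  \<comment> \<open>The second component is \<open>u\<close> divided by \<open>p u\<close>, with
    \<open>p u\<close> standing for its own inverse. The inverse of \<open>f\<close> is
    multiplication.\<close>
  define f where "f u = (p u, u \<otimes>\<^bsub>?R\<^esub> p u)" for u
  have f_bij: "bij_betw f (core_units G) (?I \<times> ?K)"
  proof (rule bij_betw_byWitness[where f' = "\<lambda>(a, b). a \<otimes>\<^bsub>?R\<^esub> b"])
    show "\<forall>u\<in>core_units G. (case f u of (a, b) \<Rightarrow> a \<otimes>\<^bsub>?R\<^esub> b) = u"
    proof
      fix u assume u: "u \<in> core_units G"
      have "p u \<otimes>\<^bsub>?R\<^esub> (u \<otimes>\<^bsub>?R\<^esub> p u) = u"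
      proof (rule eqI)
        fix H assume "H \<subseteq> carrier G"
        then show "vmark G (p u \<otimes>\<^bsub>?R\<^esub> (u \<otimes>\<^bsub>?R\<^esub> p u)) H = vmark G u H"
          using core_unitsD(3)[OF p_core[OF u]] u p_core by (simp add: vm core_units_mult)
      qed (use u p_core core_units_mult in auto)
      then show "(case f u of (a, b) \<Rightarrow> a \<otimes>\<^bsub>?R\<^esub> b) = u"
        by (simp add: f_def)
    qed
    show "\<forall>z\<in>?I \<times> ?K. f (case z of (a, b) \<Rightarrow> a \<otimes>\<^bsub>?R\<^esub> b) = z"
    proof
      fix z assume "z \<in> ?I \<times> ?K"
      then obtain v b where z: "z = (burnside_inf G N v, b)"
        and v: "v \<in> core_units (G Mod N)" and b: "b \<in> ?K"
        by blast
      let ?a = "burnside_inf G N v"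
      have a: "?a \<in> core_units G"
        using v by (rule burnside_inf_core_units)
      have b': "b \<in> core_units G" "burnside_fix G N b = \<one>\<^bsub>?Q\<^esub>"
        using b K_iff by auto
      \<comment> \<open>Inflation maps one to one: the marks of one are 1 at all subsets of the
        group.\<close>
      have "p b = \<one>\<^bsub>?R\<^esub>"
        using burnside_inf[OF Q.burnside_one(1)]
        by (intro burnside_eqI)
          (simp_all add: p_def b' burnside_one Q.burnside_one carrier_quotient subgroup.subset image_mono)
      then have "vmark G (p (?a \<otimes>\<^bsub>?R\<^esub> b)) H = vmark G ?a H" if "H \<subseteq> carrier G" for H
        using that p_mult[OF a b'(1)] p_inf[of ?a] p_core a b' v
        by (simp add: vm burnside_mult burnside_one core_unitsD(1))
      then have p_ab: "p (?a \<otimes>\<^bsub>?R\<^esub> b) = ?a"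
        using a b' p_core core_units_mult by (intro eqI) auto
      have "?a \<otimes>\<^bsub>?R\<^esub> b \<otimes>\<^bsub>?R\<^esub> ?a = b"
      proof (rule eqI)
        fix H assume "H \<subseteq> carrier G"
        then show "vmark G (?a \<otimes>\<^bsub>?R\<^esub> b \<otimes>\<^bsub>?R\<^esub> ?a) H = vmark G b H"
          using core_unitsD(3)[OF a] a b' by (simp add: vm core_units_mult)
      qed (use a b' core_units_mult in auto)
      then show "f (case z of (a, b) \<Rightarrow> a \<otimes>\<^bsub>?R\<^esub> b) = z"
        by (simp add: f_def p_ab z)
    qed
    show "f ` core_units G \<subseteq> ?I \<times> ?K"
    proof (rule image_subsetI)
      fix u assume u: "u \<in> core_units G"
      \<comment> \<open>As fixed points undo inflation, this is the square of
        \<open>burnside_fix G N u\<close>, a core-trivial unit of the quotient.\<close>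
      have "burnside_fix G N (u \<otimes>\<^bsub>?R\<^esub> p u) = \<one>\<^bsub>?Q\<^esub>"
        using Q.core_unitsD(1,4)[OF burnside_fix_core_units[OF u]] u p_core core_unitsD(1)
        by (simp add: burnside_fix_mult) (simp add: p_def burnside_fix_inf)
      then have "u \<otimes>\<^bsub>?R\<^esub> p u \<in> ?K"
        unfolding K_iff using u p_core core_units_mult by blast
      moreover have "p u \<in> ?I"
        using burnside_fix_core_units[OF u] by (simp add: p_def)
      ultimately show "f u \<in> ?I \<times> ?K"
        by (simp add: f_def)
    qed
    show "(\<lambda>(a, b). a \<otimes>\<^bsub>?R\<^esub> b) ` (?I \<times> ?K) \<subseteq> core_units G"
      using burnside_inf_core_units core_units_mult by auto
  qed
  have f_mult: "f (u \<otimes>\<^bsub>?R\<^esub> v) = (p u \<otimes>\<^bsub>?R\<^esub> p v, (u \<otimes>\<^bsub>?R\<^esub> p u) \<otimes>\<^bsub>?R\<^esub> (v \<otimes>\<^bsub>?R\<^esub> p v))"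
    if "u \<in> core_units G" "v \<in> core_units G" for u v
  proof -
    have "(u \<otimes>\<^bsub>?R\<^esub> v) \<otimes>\<^bsub>?R\<^esub> (p u \<otimes>\<^bsub>?R\<^esub> p v) = (u \<otimes>\<^bsub>?R\<^esub> p u) \<otimes>\<^bsub>?R\<^esub> (v \<otimes>\<^bsub>?R\<^esub> p v)"
      using that p_core by (intro eqI) (auto simp: vm core_units_mult)
    then show ?thesis
      using that by (simp add: f_def p_mult)
  qed
  have "f \<in> iso ((burnside_units G)\<lparr>carrier := core_units G\<rparr>)
      ((burnside_units G)\<lparr>carrier := ?I\<rparr> \<times>\<times> (burnside_units G)\<lparr>carrier := ?K\<rparr>)"
  proof (intro isoI homI)
    fix u v
    assume "u \<in> carrier ((burnside_units G)\<lparr>carrier := core_units G\<rparr>)"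
      "v \<in> carrier ((burnside_units G)\<lparr>carrier := core_units G\<rparr>)"
    then show "f (u \<otimes>\<^bsub>(burnside_units G)\<lparr>carrier := core_units G\<rparr>\<^esub> v) =
        f u \<otimes>\<^bsub>(burnside_units G)\<lparr>carrier := ?I\<rparr> \<times>\<times> (burnside_units G)\<lparr>carrier := ?K\<rparr>\<^esub> f v"
      by (simp add: units_of_mult f_mult f_def[of u] f_def[of v])
  qed (use f_bij bij_betwE[OF f_bij] in auto)
  then show ?thesis
    by (auto simp: is_iso_def)
qed

end
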